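(* Let $a,b,c$ be arbitrary real numbers, and let $Q(x,y)\equiv Q(t;x,y;a,b,c)$ be the weighted generating function of Kreweras walks in the quarter plane, i.e. walks starting at $(0,0)$, staying in $\{(k,l)\in\mathbb{Z}^2 : k,l\ge 0\}$, with steps in $\{(1,1),(0,-1),(-1,0)\}$, with weight $a$ for each visit to the $x$-axis away from the origin, weight $b$ for each visit to the $y$-axis away from the origin, and weight $c$ for each visit to the origin. Then the generating function $Q_{0,0}\equiv Q(0,0)=Q(t;0,0;a,b,c)$ of such walks ending at the origin is algebraic, i.e. this formal power series in $t$ is algebraic over $\mathbb{C}(t)$.
   Context: Generating function. For a step set $\mathcal{S}\subseteq\{-1,0,1\}^2$, let $q_{n,k,l,h,v,u}$ be the number of walks of $n$ steps, each step in $\mathcal{S}$, starting at $(0,0)$, ending at $(k,l)$, with all vertices in $\{(i,j)\in\mathbb{Z}^2: i,j\geq 0\}$, which visit the horizontal boundary (points $(i,0)$ with $i>0$) exactly $h$ times, the vertical boundary (points $(0,j)$ with $j>0$) exactly $v$ times, and the origin $(0,0)$ exactly $u$ times. The starting vertex is not counted as a visit to the origin, so the empty walk has weight $1$. Define $$Q(x,y)\equiv Q(t;x,y;a,b,c)=\sum_{n\ge 0}t^n\sum_{k,l,h,v,u}q_{n,k,l,h,v,u}\,x^k y^l a^h b^v c^u .$$ This is a formal power series in $t$ whose coefficients are polynomials in $x,y$. For Kreweras walks $\mathcal{S}=\{(1,1),(0,-1),(-1,0)\}$. *)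

theory Defs
  imports
    Complex_Main
    "HOL-Computational_Algebra.Computational_Algebra"
    "HOL-Library.Product_Plus"
begin

section \<open>Walks in the quarter plane\<close>

definition quarter_plane :: "(int \<times> int) set" where
  "quarter_plane = {(i, j). i \<ge> 0 \<and> j \<ge> 0}"

definition horizontal_boundary :: "(int \<times> int) set" where
  "horizontal_boundary = {(i, 0) | i. i > 0}"

definition vertical_boundary :: "(int \<times> int) set" where
  "vertical_boundary = {(0, j) | j. j > 0}"

text \<open>A walk of \<open>n\<close> steps is represented by the list of its \<open>n + 1\<close> vertices.\<close>

definition walks :: "(int \<times> int) set \<Rightarrow> nat \<Rightarrow> (int \<times> int) list set" where
  "walks S n = {w. length w = n + 1 \<and> w ! 0 = (0, 0) \<and> set w \<subseteq> quarter_plane \<and>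
                   (\<forall>i<n. w ! (i + 1) - w ! i \<in> S)}"

text \<open>The starting vertex, at index \<open>0\<close>, never counts as a visit.\<close>

definition visits :: "(int \<times> int) set \<Rightarrow> (int \<times> int) list \<Rightarrow> nat" where
  "visits A w = card {i. 1 \<le> i \<and> i < length w \<and> w ! i \<in> A}"

definition walk_count ::
  "(int \<times> int) set \<Rightarrow> nat \<Rightarrow> nat \<Rightarrow> nat \<Rightarrow> nat \<Rightarrow> nat \<Rightarrow> nat \<Rightarrow> nat" where
  "walk_count S n k l h v u =
     card {w \<in> walks S n. last w = (int k, int l) \<and>
             visits horizontal_boundary w = h \<and> visits vertical_boundary w = v \<and>
             visits {(0, 0)} w = u}"

text \<open>
  For \<open>S \<subseteq> {-1, 0, 1}\<^sup>2\<close> the number \<open>walk_count S n k l h v u\<close> vanishes as soon as one of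
  \<open>k, l, h, v, u\<close> exceeds \<open>n\<close> (lemma \<open>walk_count_eq_0\<close> below), so the finite sums are the full
  sums over all natural numbers. The coefficient ring is arbitrary: \<open>x\<close>, \<open>y\<close> may be
  indeterminates of a polynomial ring as well as numbers.
\<close>

definition walk_gf ::
  "(int \<times> int) set \<Rightarrow> 'a::comm_semiring_1 \<Rightarrow> 'a \<Rightarrow> 'a \<Rightarrow> 'a \<Rightarrow> 'a \<Rightarrow> 'a fps" where
  "walk_gf S x y a b c =
     Abs_fps (\<lambda>n. \<Sum>k\<le>n. \<Sum>l\<le>n. \<Sum>h\<le>n. \<Sum>v\<le>n. \<Sum>u\<le>n.
       of_nat (walk_count S n k l h v u) * x ^ k * y ^ l * a ^ h * b ^ v * c ^ u)"

lemma visits_le: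
  assumes "w \<in> walks S n"
  shows "visits A w \<le> n"
proof -
  have "{i. 1 \<le> i \<and> i < length w \<and> w ! i \<in> A} \<subseteq> {1..n}"
    using assms by (auto simp: walks_def)
  from card_mono[OF _ this] show ?thesis
    by (simp add: visits_def)
qed

lemma walk_vertex_le:
  assumes S: "S \<subseteq> {-1, 0, 1} \<times> {-1, 0, 1}" and w: "w \<in> walks S n" and "i \<le> n"
  shows "fst (w ! i) \<le> int i \<and> snd (w ! i) \<le> int i"
  using \<open>i \<le> n\<close>
proof (induction i)
  case 0
  then show ?case
    using w by (simp add: walks_def)
next
  case (Suc i)
  have "w ! (i + 1) - w ! i \<in> S"
    using w Suc.prems by (simp add: walks_def)
  with S have "w ! (i + 1) - w ! i \<in> {-1, 0, 1} \<times> {-1, 0, 1}"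
    by (rule subsetD)
  then have "fst (w ! (i + 1) - w ! i) \<in> {-1, 0, 1}" "snd (w ! (i + 1) - w ! i) \<in> {-1, 0, 1}"
    by (simp_all only: mem_Times_iff)
  then have "fst (w ! (i + 1)) - fst (w ! i) \<le> 1" "snd (w ! (i + 1)) - snd (w ! i) \<le> 1"
    by auto
  then show ?case
    using Suc by simp
qed

lemma walk_count_eq_0:
  assumes S: "S \<subseteq> {-1, 0, 1} \<times> {-1, 0, 1}" and "k > n \<or> l > n \<or> h > n \<or> v > n \<or> u > n"
  shows "walk_count S n k l h v u = 0"
proof -
  have False if w: "w \<in> walks S n" and "last w = (int k, int l)"
    "visits horizontal_boundary w = h" "visits vertical_boundary w = v" "visits {(0, 0)} w = u"
    for w
  proof -
    have "last w = w ! n"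
      using w by (cases w) (auto simp: walks_def last_conv_nth)
    then have "w ! n = (int k, int l)"
      using that(2) by simp
    then have "k \<le> n" "l \<le> n"
      using walk_vertex_le[OF S w, of n] by auto
    then show False
      using visits_le[OF w] that(3-5) assms(2) by (metis not_le)
  qed
  then have "{w \<in> walks S n. last w = (int k, int l) \<and>
      visits horizontal_boundary w = h \<and> visits vertical_boundary w = v \<and>
      visits {(0, 0)} w = u} = {}"
    by blast
  then show ?thesis
    unfolding walk_count_def by (metis card.empty)
qed

lemma finite_walks:
  assumes S: "S \<subseteq> {-1, 0, 1} \<times> {-1, 0, 1}"
  shows "finite (walks S n)"
proof (rule finite_subset)
  show "walks S n \<subseteq> {w. set w \<subseteq> {0..int n} \<times> {0..int n} \<and> length w = n + 1}"
  proof clarify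
    fix w assume w: "w \<in> walks S n"
    have "p \<in> {0..int n} \<times> {0..int n}" if "p \<in> set w" for p
    proof -
      from that obtain i where "i < length w" "p = w ! i"
        by (metis in_set_conv_nth)
      then have i: "i \<le> n" "p = w ! i"
        using w by (simp_all add: walks_def)
      have "p \<in> quarter_plane"
        using w that by (auto simp: walks_def)
      then show ?thesis
        using i walk_vertex_le[OF S w i(1)] by (auto simp: quarter_plane_def mem_Times_iff)
    qed
    then show "set w \<subseteq> {0..int n} \<times> {0..int n} \<and> length w = n + 1"
      using w by (auto simp: walks_def)
  qed
  show "finite {w. set w \<subseteq> {0..int n} \<times> {0..int n} \<and> length w = n + 1}"
    by (intro finite_lists_length_eq) auto
qed

definition kreweras_steps :: "(int \<times> int) set" where
  "kreweras_steps = {(1, 1), (0, -1), (-1, 0)}"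


section \<open>Algebraic power series\<close>

text \<open>
  The field \<open>F(t)\<close> of rational functions, as a subfield of the field \<open>F((t))\<close> of formal
  Laurent series.
\<close>

definition rational_functions :: "'a::field fls set" where
  "rational_functions =
     {fps_to_fls (fps_of_poly p) / fps_to_fls (fps_of_poly q) | p q. q \<noteq> 0}"

definition algebraic_over :: "'a::field set \<Rightarrow> 'a \<Rightarrow> bool" where
  "algebraic_over K z \<longleftrightarrow> (\<exists>P. (\<forall>i. coeff P i \<in> K) \<and> P \<noteq> 0 \<and> poly P z = 0)"

definition algebraic_fps :: "'a::field fps \<Rightarrow> bool" where
  "algebraic_fps f \<longleftrightarrow> algebraic_over rational_functions (fps_to_fls f)"

end

theory Submission
  imports Defs "HOL-Algebra.Algebraic_Closure_Type"
begin

text \<open>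
  Let \<open>\<alpha> = 1 - 1/a\<close>, \<open>\<beta> = 1 - 1/b\<close>, \<open>\<gamma> = 1 - 1/c\<close>, and write \<open>A(x)\<close>, \<open>B(y)\<close> for \<open>Q(x, 0)\<close>, \<open>Q(0, y)\<close>.
  If three series satisfy \<open>X + V + W = 1\<close> and \<open>X V W = t\<^sup>3\<close>, the kernel vanishes at \<open>x = t/X\<close>, \<open>y = t/W\<close>,
  so that \<open>(\<alpha> - W) A(t/X) + (\<beta> - X) B(t/W) + p = 0\<close> with \<open>p = 1 - \<gamma> + (\<gamma> - \<alpha> - \<beta>) Q(0, 0)\<close>.
  Using this for \<open>(X, W)\<close> and \<open>(V, W)\<close> one eliminates \<open>B(t/W)\<close>: the difference of \<open>A/(\<beta> - X)\<close> and its
  image under \<open>X \<leftrightarrow> V\<close> is \<open>p\<close> times a rational function. For \<open>\<alpha> \<noteq> \<beta>\<close> that function is not of the form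
  \<open>F(X) - F(V)\<close>, but the obstructions for \<open>A/(\<beta> - X)\<close> and \<open>B/(\<alpha> - X)\<close> cancel in the sum of the two.
  A suitable polynomial multiple of this sum, corrected by a rational term, is therefore invariant under
  \<open>X \<leftrightarrow> V\<close>, and it has a pole of order 3 at \<open>x = 0\<close>.

  An invariant without a pole is constant, and there is an explicit algebraic invariant \<open>J\<close> with a simple
  pole. Hence the sum is a cubic polynomial in \<open>J\<close>. At the two points where \<open>x = t/X\<close> is small and
  \<open>(\<beta> - X)(\<beta> - V)(\<beta> - W) = 0\<close>, namely \<open>X = \<beta>\<close> and \<open>W = \<beta>\<close>, its value is an algebraic multiple of \<open>p\<close>,
  and likewise for \<open>\<alpha>\<close>. Interpolation at these four points
  gives the leading coefficient of the cubic, whose comparison with the pole at \<open>x = 0\<close> is a linear equation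
  for \<open>Q(0, 0)\<close> with algebraic coefficients.

  The argument needs generic weights. It is applied to \<open>a + \<epsilon>\<close>, \<open>b + 2 \<epsilon>\<close>, \<open>c + \<epsilon>\<close> over the field of Laurent
  series in \<open>\<epsilon>\<close>; then \<open>\<epsilon> = 0\<close> is substituted in the algebraic equation.
\<close>

section \<open>Weighted Kreweras walks\<close>

definition vertex_weight :: "'a::comm_semiring_1 \<Rightarrow> 'a \<Rightarrow> 'a \<Rightarrow> nat \<Rightarrow> nat \<Rightarrow> 'a" where
  "vertex_weight a b c k l = (if l = 0 then if k = 0 then c else a else if k = 0 then b else 1)"

text \<open>The recursion removes the last step. A vertex is charged on arrival, so the starting
  vertex carries no weight, in agreement with \<open>visits\<close>.\<close>

primrec kreweras_weight :: "'a::comm_semiring_1 \<Rightarrow> 'a \<Rightarrow> 'a \<Rightarrow> nat \<Rightarrow> nat \<Rightarrow> nat \<Rightarrow> 'a" where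
  "kreweras_weight a b c 0 k l = (if k = 0 \<and> l = 0 then 1 else 0)"
| "kreweras_weight a b c (Suc n) k l = vertex_weight a b c k l *
     ((if k = 0 \<or> l = 0 then 0 else kreweras_weight a b c n (k - 1) (l - 1)) +
      kreweras_weight a b c n k (Suc l) + kreweras_weight a b c n (Suc k) l)"

definition walk_weight :: "'a::comm_semiring_1 \<Rightarrow> 'a \<Rightarrow> 'a \<Rightarrow> (int \<times> int) list \<Rightarrow> 'a" where
  "walk_weight a b c w =
     a ^ visits horizontal_boundary w * b ^ visits vertical_boundary w * c ^ visits {(0, 0)} w"

lemma visits_snoc:
  assumes "w \<noteq> []"
  shows "visits A (w @ [p]) = visits A w + (if p \<in> A then 1 else 0)"
proof -
  have len: "1 \<le> length w" using assms by (cases w) auto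
  have "i \<in> {i. 1 \<le> i \<and> i < length (w @ [p]) \<and> (w @ [p]) ! i \<in> A} \<longleftrightarrow>
      i \<in> {i. 1 \<le> i \<and> i < length w \<and> w ! i \<in> A} \<union> {i. i = length w \<and> p \<in> A}" for i
  proof -
    consider "i < length w" | "i = length w" | "i > length w" by linarith
    then show ?thesis
      by cases (use len in \<open>simp_all add: nth_append\<close>)
  qed
  then have eq: "{i. 1 \<le> i \<and> i < length (w @ [p]) \<and> (w @ [p]) ! i \<in> A} =
      {i. 1 \<le> i \<and> i < length w \<and> w ! i \<in> A} \<union> {i. i = length w \<and> p \<in> A}" by (rule Set.set_eqI)
  have "card {i. i = length w \<and> p \<in> A} = (if p \<in> A then 1 else 0)" by simp
  then show ?thesis
    unfolding visits_def eq by (subst card_Un_disjoint) auto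
qed

lemma boundary_iff:
  "(int k, int l) \<in> horizontal_boundary \<longleftrightarrow> k \<noteq> 0 \<and> l = 0"
  "(int k, int l) \<in> vertical_boundary \<longleftrightarrow> k = 0 \<and> l \<noteq> 0"
  "(int k, int l) \<in> {(0, 0)} \<longleftrightarrow> k = 0 \<and> l = 0"
  by (auto simp: horizontal_boundary_def vertical_boundary_def)

lemma walk_weight_snoc:
  assumes "w \<noteq> []"
  shows "walk_weight a b c (w @ [(int k, int l)]) = vertex_weight a b c k l * walk_weight a b c w"
  unfolding walk_weight_def vertex_weight_def visits_snoc[OF assms] boundary_iff
  by (cases "k = 0"; cases "l = 0") (simp_all add: mult_ac)

lemma walks_Suc:
  "w \<in> walks S (Suc n) \<longleftrightarrow>
     (\<exists>v p. w = v @ [p] \<and> v \<in> walks S n \<and> p \<in> quarter_plane \<and> p - last v \<in> S)"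
proof
  assume w: "w \<in> walks S (Suc n)"
  then have len: "length w = Suc (Suc n)" by (simp add: walks_def)
  define v p where "v = butlast w" and "p = last w"
  have eq: "w = v @ [p]" unfolding v_def p_def using len by (metis append_butlast_last_id list.size(3) nat.simps(3))
  have lenv: "length v = Suc n" using len eq by simp
  then have last: "last v = v ! n" by (metis last_conv_nth length_0_conv nat.simps(3) diff_Suc_1)
  have steps: "w ! (i + 1) - w ! i \<in> S" if "i < Suc n" for i
    using w that by (simp add: walks_def)
  have "v ! (i + 1) - v ! i \<in> S" if "i < n" for i
    using steps[of i] that lenv by (simp add: eq nth_append)
  moreover have "p - last v \<in> S"
    using steps[of n] lenv by (simp add: eq nth_append last)
  moreover have "v ! 0 = (0, 0)" "set v \<subseteq> quarter_plane" "p \<in> quarter_plane"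
    using w lenv by (auto simp: walks_def eq nth_append)
  ultimately show "\<exists>v p. w = v @ [p] \<and> v \<in> walks S n \<and> p \<in> quarter_plane \<and> p - last v \<in> S"
    using eq lenv by (auto simp: walks_def)
next
  assume "\<exists>v p. w = v @ [p] \<and> v \<in> walks S n \<and> p \<in> quarter_plane \<and> p - last v \<in> S"
  then obtain v p where eq: "w = v @ [p]" and v: "v \<in> walks S n" and p: "p \<in> quarter_plane" "p - last v \<in> S"
    by blast
  have lenv: "length v = Suc n" using v by (simp add: walks_def)
  then have last: "last v = v ! n" by (metis last_conv_nth length_0_conv nat.simps(3) diff_Suc_1)
  have "w ! (i + 1) - w ! i \<in> S" if "i < Suc n" for i
  proof (cases "i = n")
    case True
    then show ?thesis using p lenv by (simp add: eq nth_append last)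
  next
    case False
    then show ?thesis using that v lenv by (simp add: eq nth_append walks_def)
  qed
  then show "w \<in> walks S (Suc n)"
    using v p lenv by (auto simp: walks_def eq nth_append)
qed

lemma kreweras_steps_subset: "kreweras_steps \<subseteq> {-1, 0, 1} \<times> {-1, 0, 1}"
  by (auto simp: kreweras_steps_def)

definition walks_to :: "nat \<Rightarrow> int \<times> int \<Rightarrow> (int \<times> int) list set" where
  "walks_to n p = {w \<in> walks kreweras_steps n. last w = p}"

lemma finite_walks_to: "finite (walks_to n p)"
  unfolding walks_to_def using finite_walks[OF kreweras_steps_subset] by simp

lemma walks_to_outside:
  assumes "p \<notin> quarter_plane"
  shows "walks_to n p = {}"
proof -
  have "last w \<in> quarter_plane" if "w \<in> walks kreweras_steps n" for w
  proof -
    have "w \<noteq> []" using that by (auto simp: walks_def)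
    then show ?thesis using that last_in_set[of w] by (auto simp: walks_def)
  qed
  then show ?thesis using assms by (auto simp: walks_to_def)
qed

text \<open>End points are integers, so that all three predecessors are plain differences; one
  outside the quarter plane contributes the empty set by \<open>walks_to_outside\<close>.\<close>

lemma walks_to_Suc:
  "walks_to (Suc n) (int k, int l) =
     (\<lambda>w. w @ [(int k, int l)]) ` (\<Union>s\<in>kreweras_steps. walks_to n ((int k, int l) - s))"
proof -
  have q: "(int k, int l) \<in> quarter_plane" by (simp add: quarter_plane_def)
  have A: "w \<in> walks_to (Suc n) (int k, int l) \<longleftrightarrow>
      (\<exists>v. w = v @ [(int k, int l)] \<and> v \<in> walks kreweras_steps n \<and> (int k, int l) - last v \<in> kreweras_steps)" for w
    unfolding walks_to_def using q by (auto simp: walks_Suc)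
  have B: "(\<exists>s\<in>kreweras_steps. v \<in> walks_to n ((int k, int l) - s)) \<longleftrightarrow>
      v \<in> walks kreweras_steps n \<and> (int k, int l) - last v \<in> kreweras_steps" for v
    unfolding walks_to_def by (auto intro!: bexI[of _ "(int k, int l) - last v"])
  show ?thesis
  proof (rule Set.set_eqI)
    fix w
    show "w \<in> walks_to (Suc n) (int k, int l) \<longleftrightarrow>
        w \<in> (\<lambda>w. w @ [(int k, int l)]) ` (\<Union>s\<in>kreweras_steps. walks_to n ((int k, int l) - s))"
      unfolding A image_iff Bex_def UN_iff B[unfolded Bex_def] by (rule ex_cong1) (rule conj_commute)
  qed
qed

text \<open>The walks to the three predecessors form disjoint sets, told apart by their last vertex,
  and appending a vertex multiplies the weight by its \<open>vertex_weight\<close>.\<close>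

lemma sum_walk_weight:
  "(\<Sum>w\<in>walks_to n (int k, int l). walk_weight a b c w) = kreweras_weight a b c n k l"
proof (induction n arbitrary: k l)
  case 0
  have W: "walks kreweras_steps 0 = {[(0, 0)]}"
    by (auto simp: walks_def quarter_plane_def length_Suc_conv)
  have "visits A [(0, 0)] = 0" for A
    by (auto simp: visits_def)
  then have "walk_weight a b c [(0, 0)] = 1"
    by (simp add: walk_weight_def)
  moreover have "walks_to 0 (int k, int l) = (if k = 0 \<and> l = 0 then {[(0, 0)]} else {})"
    unfolding walks_to_def W by auto
  ultimately show ?case by simp
next
  case (Suc n)
  let ?p = "(int k, int l)"
  have ne: "w \<noteq> []" if "w \<in> walks_to n p" for w p
    using that by (auto simp: walks_to_def walks_def)
  have "(\<Sum>w\<in>walks_to (Suc n) ?p. walk_weight a b c w) =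
      (\<Sum>w\<in>(\<Union>s\<in>kreweras_steps. walks_to n (?p - s)). walk_weight a b c (w @ [?p]))"
    unfolding walks_to_Suc by (subst sum.reindex) (auto simp: inj_on_def)
  also have "\<dots> = (\<Sum>w\<in>(\<Union>s\<in>kreweras_steps. walks_to n (?p - s)).
      vertex_weight a b c k l * walk_weight a b c w)"
    by (rule sum.cong) (auto intro!: walk_weight_snoc dest: ne)
  also have "\<dots> = vertex_weight a b c k l *
      (\<Sum>s\<in>kreweras_steps. \<Sum>w\<in>walks_to n (?p - s). walk_weight a b c w)"
    unfolding sum_distrib_left[symmetric]
    by (subst sum.UNION_disjoint)
      (auto simp: kreweras_steps_def finite_walks_to, auto simp: walks_to_def)
  also have "(\<Sum>s\<in>kreweras_steps. \<Sum>w\<in>walks_to n (?p - s). walk_weight a b c w) =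
      (\<Sum>w\<in>walks_to n (int k - 1, int l - 1). walk_weight a b c w) +
      ((\<Sum>w\<in>walks_to n (int k, int l + 1). walk_weight a b c w) +
      (\<Sum>w\<in>walks_to n (int k + 1, int l). walk_weight a b c w))"
    by (simp add: kreweras_steps_def)
  also have "(\<Sum>w\<in>walks_to n (int k, int l + 1). walk_weight a b c w) = kreweras_weight a b c n k (Suc l)"
    using Suc[of k "Suc l"] unfolding of_nat_Suc add.commute[of 1] .
  also have "(\<Sum>w\<in>walks_to n (int k + 1, int l). walk_weight a b c w) = kreweras_weight a b c n (Suc k) l"
    using Suc[of "Suc k" l] unfolding of_nat_Suc add.commute[of 1] .
  also have "(\<Sum>w\<in>walks_to n (int k - 1, int l - 1). walk_weight a b c w) =
      (if k = 0 \<or> l = 0 then 0 else kreweras_weight a b c n (k - 1) (l - 1))"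
  proof (cases "k = 0 \<or> l = 0")
    case True
    then have "(int k - 1, int l - 1) \<notin> quarter_plane" by (auto simp: quarter_plane_def)
    then show ?thesis using True by (simp add: walks_to_outside)
  next
    case False
    then have *: "int k - 1 = int (k - 1)" "int l - 1 = int (l - 1)" by auto
    show ?thesis unfolding * Suc using False by (rule if_not_P[symmetric])
  qed
  finally show ?case unfolding kreweras_weight.simps(2) add.assoc .
qed

lemma sum_fibre_le:
  fixes f :: "'b \<Rightarrow> nat" and g :: "'b \<Rightarrow> 'a::comm_semiring_1"
  assumes "finite A" "\<And>x. x \<in> A \<Longrightarrow> f x \<le> n"
  shows "(\<Sum>i\<le>n. \<Sum>x\<in>{x \<in> A. f x = i}. g x) = sum g A"
  by (rule sum.group) (use assms in auto)

text \<open>At \<open>x = y = 0\<close> only \<open>k = l = 0\<close> survives, since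
  \<open>0 ^ 0 = 1\<close>. The sums over \<open>h\<close>, \<open>v\<close>, \<open>u\<close> sort
  the excursions by numbers of visits, and \<open>sum_fibre_le\<close> collapses them one at a
  time.\<close>

lemma walk_gf_nth:
  "walk_gf kreweras_steps 0 0 a b c $ n = kreweras_weight a b c n 0 0"
proof -
  let ?h = "visits horizontal_boundary" and ?v = "visits vertical_boundary" and ?u = "visits {(0, 0)}"
  let ?E = "walks_to n (0, 0)"
  have fin: "finite ?E" by (rule finite_walks_to)
  have le: "visits A w \<le> n" if "w \<in> ?E" for A w
    using that visits_le by (auto simp: walks_to_def)
  have zero: "(\<Sum>k\<le>n. (0::'a) ^ k * f k) = f 0" for f
  proof -
    have "(\<Sum>k\<le>n. (0::'a) ^ k * f k) = (\<Sum>k\<le>n. if k = 0 then f 0 else 0)"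
      by (rule sum.cong) (auto simp: power_0_left)
    then show ?thesis by simp
  qed
  have "walk_gf kreweras_steps 0 0 a b c $ n =
      (\<Sum>k\<le>n. 0 ^ k * (\<Sum>l\<le>n. 0 ^ l * (\<Sum>h\<le>n. \<Sum>v\<le>n. \<Sum>u\<le>n.
        of_nat (walk_count kreweras_steps n k l h v u) * a ^ h * b ^ v * c ^ u)))"
    unfolding walk_gf_def fps_nth_Abs_fps sum_distrib_left
    by (intro sum.cong refl) (simp add: ac_simps)
  also have "\<dots> = (\<Sum>h\<le>n. \<Sum>v\<le>n. \<Sum>u\<le>n.
      of_nat (walk_count kreweras_steps n 0 0 h v u) * a ^ h * b ^ v * c ^ u)"
    by (simp add: zero)
  also have "\<dots> = (\<Sum>h\<le>n. \<Sum>v\<le>n. \<Sum>u\<le>n. \<Sum>w\<in>{w \<in> {w \<in> {w \<in> ?E. ?h w = h}. ?v w = v}. ?u w = u}.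
      walk_weight a b c w)"
  proof (intro sum.cong refl)
    fix h v u
    have "{w \<in> walks kreweras_steps n. last w = (int 0, int 0) \<and> ?h w = h \<and> ?v w = v \<and> ?u w = u} =
        {w \<in> {w \<in> {w \<in> ?E. ?h w = h}. ?v w = v}. ?u w = u}"
      by (auto simp: walks_to_def)
    then show "of_nat (walk_count kreweras_steps n 0 0 h v u) * a ^ h * b ^ v * c ^ u =
      (\<Sum>w\<in>{w \<in> {w \<in> {w \<in> ?E. ?h w = h}. ?v w = v}. ?u w = u}. walk_weight a b c w)"
      unfolding walk_count_def by (simp add: walk_weight_def ac_simps)
  qed
  also have "\<dots> = (\<Sum>h\<le>n. \<Sum>v\<le>n. \<Sum>w\<in>{w \<in> {w \<in> ?E. ?h w = h}. ?v w = v}. walk_weight a b c w)"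
    by (intro sum.cong refl sum_fibre_le) (use fin le in auto)
  also have "\<dots> = (\<Sum>h\<le>n. \<Sum>w\<in>{w \<in> ?E. ?h w = h}. walk_weight a b c w)"
    by (intro sum.cong refl sum_fibre_le) (use fin le in auto)
  also have "\<dots> = (\<Sum>w\<in>?E. walk_weight a b c w)"
    by (intro sum_fibre_le) (use fin le in auto)
  finally show ?thesis using sum_walk_weight[of a b c n 0 0] by simp
qed

lemma vertex_weight_commute: "vertex_weight a b c k l = vertex_weight b a c l k"
  by (simp add: vertex_weight_def)

lemma kreweras_weight_commute: "kreweras_weight a b c n k l = kreweras_weight b a c n l k"
  by (induction n arbitrary: k l) (simp_all add: vertex_weight_commute[of a] ac_simps disj_commute)

text \<open>A step changes \<open>2 * k - l\<close> by 1, 1 or -2, so this quantity is at most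
  \<open>n\<close>; likewise with the axes exchanged. On the axis \<open>l = 0\<close> this gives
  \<open>2 * k \<le> n\<close>, on which the encoding of \<open>boundary_gf\<close> relies.\<close>

lemma kreweras_weight_eq_0:
  "n < k \<or> n < l \<or> n + l < 2 * k \<or> n + k < 2 * l \<Longrightarrow> kreweras_weight a b c n k l = 0"
proof (induction n arbitrary: k l)
  case (Suc n)
  have "kreweras_weight a b c n (k - 1) (l - 1) = 0" if "k \<noteq> 0" "l \<noteq> 0"
    using Suc.prems that by (intro Suc.IH) arith
  moreover have "kreweras_weight a b c n k (Suc l) = 0"
    using Suc.prems by (intro Suc.IH) arith
  moreover have "kreweras_weight a b c n (Suc k) l = 0"
    using Suc.prems by (intro Suc.IH) arith
  ultimately show ?case by simp
qed auto

lemma kreweras_weight_hom: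
  fixes h :: "'a::comm_semiring_1 \<Rightarrow> 'b::comm_semiring_1"
  assumes "h 0 = 0" "h 1 = 1" "\<And>x y. h (x + y) = h x + h y" "\<And>x y. h (x * y) = h x * h y"
  shows "h (kreweras_weight a b c n k l) = kreweras_weight (h a) (h b) (h c) n k l"
proof (induction n arbitrary: k l)
  case (Suc n)
  have "h (vertex_weight a b c k l) = vertex_weight (h a) (h b) (h c) k l"
    using assms(2) by (simp add: vertex_weight_def)
  then show ?case using assms(1) by (simp add: assms(3,4) Suc)
qed (use assms in simp)

section \<open>Evaluation of power series at power series\<close>

lemma fps_mult_power_nth_eq_0:
  fixes w :: "'a::comm_ring_1 fps"
  assumes "w $ 0 = 0" "m < k"
  shows "(g * w ^ k) $ m = 0"
  unfolding fps_mult_nth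
  by (rule sum.neutral) (use assms startsby_zero_power_prefix[of w k] in auto)

text \<open>Substitution for the outer variable of a series whose coefficients are series in t. If
  \<open>w $ 0 = 0\<close>, the powers \<open>w ^ k\<close> with \<open>k > m\<close> do not reach
  coefficient \<open>m\<close>, so the truncated sum is the full one.\<close>

definition fps_eval :: "'a::comm_ring_1 fps fps \<Rightarrow> 'a fps \<Rightarrow> 'a fps" where
  "fps_eval f w = Abs_fps (\<lambda>m. \<Sum>k\<le>m. (f $ k * w ^ k) $ m)"

lemma fps_eval_nth:
  fixes w :: "'a::comm_ring_1 fps"
  assumes w: "w $ 0 = 0" and "m \<le> M"
  shows "fps_eval f w $ m = (\<Sum>k\<le>M. f $ k * w ^ k) $ m"
proof -
  have "(\<Sum>k\<le>m. (f $ k * w ^ k) $ m) = (\<Sum>k\<le>M. (f $ k * w ^ k) $ m)"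
    by (rule sum.mono_neutral_left) (use assms fps_mult_power_nth_eq_0[OF w] in auto)
  then show ?thesis by (simp add: fps_eval_def fps_sum_nth)
qed

lemma fps_eval_const [simp]: "fps_eval (fps_const c) w = c"
proof (rule fps_ext)
  fix m
  have "fps_eval (fps_const c) w $ m = (\<Sum>k\<le>m. if k = 0 then c $ m else 0)"
    unfolding fps_eval_def fps_nth_Abs_fps by (rule sum.cong) auto
  then show "fps_eval (fps_const c) w $ m = c $ m" by simp
qed

lemma fps_eval_1 [simp]: "fps_eval 1 w = 1"
  using fps_eval_const[of 1 w] by simp

lemma fps_eval_X:
  assumes "w $ 0 = 0"
  shows "fps_eval fps_X w = w"
proof (rule fps_ext)
  fix m
  have "fps_eval fps_X w $ m = (\<Sum>k\<le>m. if k = 1 then w $ m else 0)"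
    unfolding fps_eval_def fps_nth_Abs_fps by (rule sum.cong) auto
  then show "fps_eval fps_X w $ m = w $ m" using assms by (cases m) simp_all
qed

lemma fps_eval_add: "fps_eval (f + g) w = fps_eval f w + fps_eval g w"
  by (rule fps_ext) (simp add: fps_eval_def ring_distribs sum.distrib)

lemma fps_eval_mult:
  fixes w :: "'a::comm_ring_1 fps"
  assumes w: "w $ 0 = 0"
  shows "fps_eval (f * g) w = fps_eval f w * fps_eval g w"
proof (rule fps_ext)
  fix m
  let ?t = "\<lambda>i j. f $ i * w ^ i * (g $ j * w ^ j)"
  have "(fps_eval f w * fps_eval g w) $ m =
      ((\<Sum>i\<le>m. f $ i * w ^ i) * (\<Sum>j\<le>m. g $ j * w ^ j)) $ m"
    unfolding fps_mult_nth
    by (rule sum.cong) (simp_all add: fps_eval_nth[OF w, of _ m])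
  also have "\<dots> = (\<Sum>(i, j)\<in>{..m} \<times> {..m}. ?t i j $ m)"
    by (simp add: sum_product fps_sum_nth sum.cartesian_product case_prod_unfold)
  \<comment> \<open>The square is cut down to a triangle: outside it \<open>w ^ (i + j)\<close> has
    order greater than \<open>m\<close>.\<close>
  also have "\<dots> = (\<Sum>(i, j)\<in>{(i, j). i + j \<le> m}. ?t i j $ m)"
  proof (rule sum.mono_neutral_right)
    have "?t i j = f $ i * g $ j * w ^ (i + j)" for i j
      by (simp add: power_add ac_simps)
    then have "?t i j $ m = 0" if "m < i + j" for i j
      using fps_mult_power_nth_eq_0[OF w that] by metis
    then show "\<forall>p\<in>{..m} \<times> {..m} - {(i, j). i + j \<le> m}. (case p of (i, j) \<Rightarrow> ?t i j $ m) = 0"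
      by (auto, metis not_le)
  qed auto
  also have "\<dots> = (\<Sum>k\<le>m. \<Sum>i\<le>k. ?t i (k - i) $ m)"
    by (rule sum.triangle_reindex_eq)
  also have "\<dots> = (\<Sum>k\<le>m. ((f * g) $ k * w ^ k) $ m)"
  proof (rule sum.cong[OF refl])
    fix k
    have "f $ i * g $ (k - i) * w ^ k = ?t i (k - i)" if "i \<le> k" for i
      using power_add[of w i "k - i"] that by (simp add: mult_ac)
    then have "(f * g) $ k * w ^ k = (\<Sum>i\<le>k. ?t i (k - i))"
      by (simp add: fps_mult_nth atLeast0AtMost sum_distrib_right)
    then show "(\<Sum>i\<le>k. ?t i (k - i) $ m) = ((f * g) $ k * w ^ k) $ m"
      by (simp add: fps_sum_nth)
  qed
  finally show "fps_eval (f * g) w $ m = (fps_eval f w * fps_eval g w) $ m"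
    by (simp add: fps_eval_def)
qed

section \<open>Power series defined by fixed-point equations\<close>

lemma fps_mult_nth_cong:
  assumes "\<And>i. i < n \<Longrightarrow> f $ i = g $ i" "\<And>i. i < n \<Longrightarrow> p $ i = q $ i" "i < n"
  shows "(f * p) $ i = (g * q) $ i"
  unfolding fps_mult_nth by (rule sum.cong) (use assms in auto)

text \<open>Each application of \<open>\<Phi>\<close> makes one more coefficient final, so the
  iterates from 0 converge coefficientwise.\<close>

lemma fps_fixpoint:
  fixes \<Phi> :: "'a::zero fps \<Rightarrow> 'a fps"
  assumes contr: "\<And>f g n. (\<And>i. i < n \<Longrightarrow> f $ i = g $ i) \<Longrightarrow> \<Phi> f $ n = \<Phi> g $ n"
  shows "\<exists>f. f = \<Phi> f"
proof -
  define F where "F n = (\<Phi> ^^ n) 0" for n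
  have F_Suc: "F (Suc n) = \<Phi> (F n)" for n by (simp add: F_def)
  have step: "F n $ i = F (Suc n) $ i" if "i < n" for n i
    using that
  proof (induction n arbitrary: i)
    case (Suc n)
    show ?case unfolding F_Suc[of "Suc n"] unfolding F_Suc[of n]
      by (rule contr) (use Suc in \<open>auto simp: F_Suc\<close>)
  qed simp
  have stable: "F (n + d) $ i = F n $ i" if "i < n" for n d i
  proof (induction d)
    case (Suc d)
    then show ?case using step[of i "n + d"] that by simp
  qed simp
  \<comment> \<open>Iterate \<open>Suc i\<close> is the first one for which \<open>stable\<close>
    guarantees coefficient \<open>i\<close>.\<close>
  define f where "f = Abs_fps (\<lambda>i. F (Suc i) $ i)"
  have f: "f $ i = F n $ i" if "i < n" for i n
    using stable[of i "Suc i" "n - Suc i"] that by (simp add: f_def)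
  have "\<Phi> f $ n = f $ n" for n
    using contr[of n f "F n"] f by (simp add: f_def F_Suc)
  then show ?thesis by (intro exI[of _ f] fps_ext) simp
qed

text \<open>A common source for the implicitly defined series below: the inverse of
  \<open>W\<close>, the series \<open>\<omega>\<close>, the square root \<open>S\<close>, and the
  special points of the kernel. The factor \<open>fps_X\<close> makes the map contracting.\<close>

lemma fps_cubic_fixpoint:
  fixes a0 :: "'a::comm_ring_1 fps"
  shows "\<exists>f. f = a0 + fps_X * (a1 * f + a2 * f\<^sup>2 + a3 * f ^ 3)"
proof (rule fps_fixpoint)
  fix f g :: "'a fps" and n
  assume *: "\<And>i. i < n \<Longrightarrow> f $ i = g $ i"
  have sq: "(f\<^sup>2) $ i = (g\<^sup>2) $ i" if "i < n" for i
    unfolding power2_eq_square using * that by (intro fps_mult_nth_cong)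
  have cube: "(f ^ 3) $ i = (g ^ 3) $ i" if "i < n" for i
    unfolding power3_eq_cube power2_eq_square[symmetric]
    using sq * that by (intro fps_mult_nth_cong[of n]) (auto simp flip: power2_eq_square)
  have "(h * f) $ i = (h * g) $ i" "(h * f\<^sup>2) $ i = (h * g\<^sup>2) $ i"
    "(h * f ^ 3) $ i = (h * g ^ 3) $ i" if "i < n" for h i
    by (intro fps_mult_nth_cong[of n]; use * sq cube that in simp)+
  then show "(a0 + fps_X * (a1 * f + a2 * f\<^sup>2 + a3 * f ^ 3)) $ n =
    (a0 + fps_X * (a1 * g + a2 * g\<^sup>2 + a3 * g ^ 3)) $ n"
    by simp
qed

section \<open>The kernel equation\<close>

text \<open>This is Q(x, 0) written by means of
  \<open>t ^ n * x ^ k = t ^ (n - 2 * k) * (t ^ 2 * x) ^ k\<close>: the outer variable is t^2 x, the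
  inner one t. Exchanging \<open>a\<close> and \<open>b\<close> gives the series of the other
  axis.\<close>

definition boundary_gf :: "'a::comm_ring_1 \<Rightarrow> 'a \<Rightarrow> 'a \<Rightarrow> 'a fps fps" where
  "boundary_gf a b c = Abs_fps (\<lambda>k. Abs_fps (\<lambda>j. kreweras_weight a b c (j + 2 * k) k 0))"

lemma fps_X_power_mult_power_nth_eq_0:
  fixes w :: "'a::comm_ring_1 fps"
  assumes "w $ 0 = 0" "j < p + k"
  shows "(fps_X ^ p * w ^ k * g) $ j = 0"
proof -
  have "w = fps_X * fps_shift 1 w"
    using assms(1) by (intro fps_ext) simp
  then have "w ^ k = fps_X ^ k * fps_shift 1 w ^ k"
    by (metis power_mult_distrib)
  then have "fps_X ^ p * w ^ k * g = fps_X ^ (p + k) * (fps_shift 1 w ^ k * g)"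
    by (simp add: power_add mult_ac)
  then show ?thesis using assms(2) by (simp add: fps_X_power_mult_nth)
qed

text \<open>Coefficient \<open>i\<close> involves only \<open>k \<le> i\<close> and
  \<open>n = j + 2 * k\<close> with \<open>j \<le> i\<close>, hence only
  \<open>n \<le> 3 * i\<close>. For \<open>n < 2 * k\<close> the truncated exponent does no harm
  because the weight is 0.\<close>

lemma boundary_gf_partial_sum:
  fixes w :: "'a::comm_ring_1 fps"
  assumes w: "w $ 0 = 0" and N: "3 * i \<le> N"
  shows "(\<Sum>n\<le>N. \<Sum>k\<le>N. fps_const (kreweras_weight a b c n k 0) * (fps_X ^ (n - 2 * k) * w ^ k)) $ i =
    fps_eval (boundary_gf a b c) w $ i"
proof -
  let ?c = "\<lambda>n k. kreweras_weight a b c n k 0"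
  let ?P = "\<lambda>k. \<Sum>n\<le>N. fps_const (?c n k) * fps_X ^ (n - 2 * k)"
  have "(\<Sum>n\<le>N. \<Sum>k\<le>N. fps_const (?c n k) * (fps_X ^ (n - 2 * k) * w ^ k)) = (\<Sum>k\<le>N. ?P k * w ^ k)"
    by (subst sum.swap) (simp add: sum_distrib_right mult.assoc)
  moreover have "(?P k * w ^ k) $ i = (boundary_gf a b c $ k * w ^ k) $ i" for k
  proof (cases "i < k")
    case True
    then show ?thesis by (simp only: fps_mult_power_nth_eq_0[OF w])
  next
    case False
    have "?P k $ j = boundary_gf a b c $ k $ j" if "j \<le> i" for j
    proof -
      have "?P k $ j = (\<Sum>n\<le>N. if n = j + 2 * k then ?c n k else 0)"
        unfolding fps_sum_nth
      proof (rule sum.cong[OF refl])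
        fix n
        show "(fps_const (?c n k) * fps_X ^ (n - 2 * k)) $ j = (if n = j + 2 * k then ?c n k else 0)"
          using kreweras_weight_eq_0[of n k 0 a b c] by (cases "n < 2 * k") (auto simp: fps_X_power_iff)
      qed
      then show ?thesis using that False N by (simp add: boundary_gf_def)
    qed
    then show ?thesis unfolding fps_mult_nth by (intro sum.cong) auto
  qed
  ultimately show ?thesis
    using N by (simp add: fps_eval_nth[OF w, of i N] fps_sum_nth)
qed

lemma sum_atMost_pred:
  fixes N :: nat
  shows "(\<Sum>k\<le>N. if k = 0 then 0 else f (k - 1)) = (\<Sum>k<N. f k :: 'a::comm_monoid_add)"
  by (simp add: sum.atMost_shift)

text \<open>
  In the variables \<open>\<xi> = t/x\<close>, \<open>W = t/y\<close> the kernel vanishes iff \<open>\<xi> + W + t x y = 1\<close>.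
  The series are evaluated at \<open>w = t\<^sup>2 x\<close>, because a walk of length \<open>n\<close> that ends at \<open>(k, 0)\<close>
  has \<open>n \<ge> 2 k\<close>.
\<close>

lemma kernel_equation:
  fixes a b c \<alpha> \<beta> \<gamma> :: "'a::comm_ring_1" and w y W \<xi> :: "'a fps"
  assumes inv: "a * (1 - \<alpha>) = 1" "b * (1 - \<beta>) = 1" "c * (1 - \<gamma>) = 1"
    and w: "w $ 0 = 0" and Xw: "\<xi> * w = fps_X ^ 3" and Wy: "W * y = 1"
    and kernel: "\<xi> + W + w * y = 1"
  shows "(fps_const \<alpha> - W) * fps_eval (boundary_gf a b c) w +
    (fps_const \<beta> - \<xi>) * fps_eval (boundary_gf b a c) (fps_X ^ 3 * y) +
    fps_const (1 - \<gamma>) + fps_const (\<gamma> - \<alpha> - \<beta>) * (boundary_gf a b c $ 0) = 0"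
    (is "?lhs = 0")
proof (rule fps_ext)
  fix i :: nat
  \<comment> \<open>A length that serves two purposes: the boundary sums up to \<open>N\<close> are
    complete at coefficient \<open>i\<close>, and the terms of length exactly \<open>N\<close> have
    order at least \<open>(N + l) / 2 > i\<close>.\<close>
  define N where "N = 3 * i + 2"
  define kw where "kw = kreweras_weight a b c"
  \<comment> \<open>Here \<open>y\<close> is the second catalytic variable divided by t, and
    \<open>w\<close> is t^2 times the first. So this is the weighted monomial of the walks of length
    \<open>n\<close> ending at \<open>(k, l)\<close>.\<close>
  define t where "t n k l = fps_const (kw n k l) * (fps_X ^ (n + l - 2 * k) * w ^ k * y ^ l)" for n k l
  define M where "M n = (\<Sum>k\<le>N. \<Sum>l\<le>N. t n k l)" for n
  define A where "A n = (\<Sum>k\<le>N. t n k 0)" for n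
  define B where "B n = (\<Sum>l\<le>N. t n 0 l)" for n
  \<comment> \<open>Since \<open>1 - cor k l\<close> inverts the vertex weight, multiplying the
    recursion by it leaves unweighted steps and turns the weights into corrections on the
    axes.\<close>
  define cor where "cor k l = (if l = 0 then if k = 0 then \<gamma> else \<alpha> else if k = 0 then \<beta> else 0)" for k l :: nat
  have vw: "vertex_weight a b c k l * (1 - cor k l) = 1" for k l
    using inv by (simp add: vertex_weight_def cor_def)
  have t0: "t n k l = 0" if "n < k \<or> n < l" for n k l
    using kreweras_weight_eq_0[of n k l a b c] that by (auto simp: t_def kw_def)
  have t_step: "t (Suc n) k l * fps_const (1 - cor k l) =
      (if k = 0 \<or> l = 0 then 0 else w * y * t n (k - 1) (l - 1)) + W * t n k (Suc l) + \<xi> * t n (Suc k) l"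
    for n k l
  proof -
    let ?m = "fps_X ^ (Suc n + l - 2 * k) * w ^ k * y ^ l"
    let ?U = "if k = 0 \<or> l = 0 then 0 else kw n (k - 1) (l - 1)"
    have "t (Suc n) k l * fps_const (1 - cor k l) = fps_const (kw (Suc n) k l * (1 - cor k l)) * ?m"
      unfolding t_def by (simp add: mult_ac flip: fps_const_mult)
    also have "kw (Suc n) k l * (1 - cor k l) =
        (vertex_weight a b c k l * (1 - cor k l)) * (?U + kw n k (Suc l) + kw n (Suc k) l)"
      by (simp add: kw_def mult_ac)
    also have "fps_const \<dots> * ?m =
        fps_const ?U * ?m + fps_const (kw n k (Suc l)) * ?m + fps_const (kw n (Suc k) l) * ?m"
      unfolding vw by (simp only: mult_1_left fps_const_add[symmetric] distrib_right)
    also have "fps_const ?U * ?m = (if k = 0 \<or> l = 0 then 0 else w * y * t n (k - 1) (l - 1))"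
      by (cases k; cases l) (simp_all add: t_def mult_ac)
    also have "fps_const (kw n k (Suc l)) * ?m = W * t n k (Suc l)"
    proof -
      have "W * t n k (Suc l) = fps_const (kw n k (Suc l)) * ?m * (W * y)"
        unfolding t_def by (simp add: mult_ac)
      then show ?thesis by (simp only: Wy mult_1_right)
    qed
    also have "fps_const (kw n (Suc k) l) * ?m = \<xi> * t n (Suc k) l"
    proof (cases "n + l < 2 * Suc k")
      case True
      then show ?thesis using kreweras_weight_eq_0[of n "Suc k" l a b c] by (simp add: t_def kw_def)
    next
      case False
      have "\<xi> * t n (Suc k) l = fps_const (kw n (Suc k) l) *
          (fps_X ^ (n + l - 2 * Suc k) * w ^ k * y ^ l) * (\<xi> * w)"
        unfolding t_def by (simp add: mult_ac)
      moreover have "Suc n + l - 2 * k = (n + l - 2 * Suc k) + 3" using False by simp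
      then have "(fps_X :: 'a fps) ^ (Suc n + l - 2 * k) = fps_X ^ (n + l - 2 * Suc k) * fps_X ^ 3"
        by (simp only: power_add)
      ultimately show ?thesis unfolding Xw by (simp only: mult_ac)
    qed
    finally show ?thesis .
  qed
  \<comment> \<open>Summing over all end points, the kernel condition gives \<open>M n\<close> the
    coefficient 1. Only boundary terms remain besides it, and the relation telescopes in
    \<open>n\<close>.\<close>
  have step: "M (Suc n) = M n + fps_const \<alpha> * (A (Suc n) - t (Suc n) 0 0) +
      fps_const \<beta> * (B (Suc n) - t (Suc n) 0 0) + fps_const \<gamma> * t (Suc n) 0 0 - W * A n - \<xi> * B n"
    if "n < N" for n
  proof -
    have cor_sum: "(\<Sum>k\<le>N. \<Sum>l\<le>N. t (Suc n) k l * fps_const (cor k l)) =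
      fps_const \<alpha> * (A (Suc n) - t (Suc n) 0 0) +
      fps_const \<beta> * (B (Suc n) - t (Suc n) 0 0) + fps_const \<gamma> * t (Suc n) 0 0"
      unfolding A_def B_def sum.atMost_shift[of _ N]
      by (simp add: cor_def sum_distrib_left mult.commute)
    have l_shift: "(\<Sum>l\<le>N. t n k (Suc l)) = (\<Sum>l\<le>N. t n k l) - t n k 0" for k
      using sum.atMost_Suc_shift[of "t n k" N] sum.atMost_Suc[of "t n k" N] t0[of n "Suc N" k] t0[of n k "Suc N"] that
      by (simp add: algebra_simps)
    have k_shift: "(\<Sum>k\<le>N. t n (Suc k) l) = (\<Sum>k\<le>N. t n k l) - t n 0 l" for l
      using sum.atMost_Suc_shift[of "\<lambda>k. t n k l" N] sum.atMost_Suc[of "\<lambda>k. t n k l" N] t0[of n "Suc N" l] that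
      by (simp add: algebra_simps)
    have "(\<Sum>k\<le>N. \<Sum>l\<le>N. if k = 0 \<or> l = 0 then 0 else w * y * t n (k - 1) (l - 1)) =
        (\<Sum>k\<le>N. if k = 0 then 0 else \<Sum>l\<le>N. if l = 0 then 0 else w * y * t n (k - 1) (l - 1))"
      by (intro sum.cong) auto
    also have "\<dots> = (\<Sum>k<N. \<Sum>l<N. w * y * t n k l)"
      unfolding sum_atMost_pred[of "\<lambda>l. w * y * t n _ l" N] sum_atMost_pred[of "\<lambda>k. \<Sum>l<N. w * y * t n k l" N] ..
    also have "\<dots> = w * y * M n"
      using t0[of n N] t0[of n _ N] that
      by (simp add: M_def sum_distrib_left lessThan_Suc_atMost[symmetric])
    finally have U: "(\<Sum>k\<le>N. \<Sum>l\<le>N. if k = 0 \<or> l = 0 then 0 else w * y * t n (k - 1) (l - 1)) = w * y * M n" .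
    have D: "(\<Sum>k\<le>N. \<Sum>l\<le>N. W * t n k (Suc l)) = W * (M n - A n)"
      unfolding sum_distrib_left[symmetric] l_shift by (simp add: M_def A_def sum_subtractf)
    have L: "(\<Sum>k\<le>N. \<Sum>l\<le>N. \<xi> * t n (Suc k) l) = \<xi> * (M n - B n)"
    proof -
      have "M n = (\<Sum>l\<le>N. \<Sum>k\<le>N. t n k l)" unfolding M_def by (rule sum.swap)
      moreover have "(\<Sum>k\<le>N. \<Sum>l\<le>N. \<xi> * t n (Suc k) l) = (\<Sum>l\<le>N. \<Sum>k\<le>N. \<xi> * t n (Suc k) l)"
        by (rule sum.swap)
      ultimately show ?thesis
        by (simp only: B_def sum_distrib_left[symmetric] k_shift sum_subtractf)
    qed
    have "M (Suc n) - (\<Sum>k\<le>N. \<Sum>l\<le>N. t (Suc n) k l * fps_const (cor k l)) =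
        (\<Sum>k\<le>N. \<Sum>l\<le>N. t (Suc n) k l * fps_const (1 - cor k l))"
      unfolding M_def sum_subtractf[symmetric]
      by (simp add: algebra_simps flip: fps_const_sub)
    also have "\<dots> = w * y * M n + W * (M n - A n) + \<xi> * (M n - B n)"
      unfolding t_step sum.distrib U D L ..
    also have "\<dots> = (\<xi> + W + w * y) * M n - W * A n - \<xi> * B n"
      by (simp add: algebra_simps)
    finally show ?thesis unfolding kernel cor_sum by (simp add: algebra_simps)
  qed
  have init: "M 0 = 1" "A 0 = 1" "B 0 = 1" "t 0 0 0 = 1"
  proof -
    have "t 0 k l = (if k = 0 \<and> l = 0 then 1 else 0)" for k l
      by (simp add: t_def kw_def)
    then show "M 0 = 1" "A 0 = 1" "B 0 = 1" "t 0 0 0 = 1"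
      by (simp_all add: M_def A_def B_def sum.atMost_shift)
  qed
  define SA where "SA = (\<Sum>n\<le>N. A n)"
  define SB where "SB = (\<Sum>n\<le>N. B n)"
  define SQ where "SQ = (\<Sum>n\<le>N. t n 0 0)"
  have tele: "M m = 1 + fps_const \<alpha> * ((\<Sum>n\<le>m. A n) - (\<Sum>n\<le>m. t n 0 0)) +
      fps_const \<beta> * ((\<Sum>n\<le>m. B n) - (\<Sum>n\<le>m. t n 0 0)) +
      fps_const \<gamma> * ((\<Sum>n\<le>m. t n 0 0) - 1) - W * ((\<Sum>n\<le>m. A n) - A m) - \<xi> * ((\<Sum>n\<le>m. B n) - B m)"
    if "m \<le> N" for m
    using that
  proof (induction m)
    case (Suc m)
    then show ?case by (simp add: step algebra_simps)
  qed (simp add: init)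
  \<comment> \<open>A nonzero term has \<open>2 * k \<le> N + l\<close>, so its order
    \<open>N + l - k\<close> is at least half of \<open>N + l\<close> and exceeds
    \<open>i\<close>.\<close>
  have tN: "t N k l $ j = 0" if "j \<le> i" for k l j
  proof (cases "N + l < 2 * k \<or> N < k")
    case True
    then show ?thesis using kreweras_weight_eq_0[of N k l a b c] by (auto simp: t_def kw_def)
  next
    case False
    then have "j < (N + l - 2 * k) + k" using that by (auto simp: N_def)
    then show ?thesis
      unfolding t_def by (simp add: fps_X_power_mult_power_nth_eq_0[OF w])
  qed
  have MN: "M N $ i = 0"
    by (simp add: M_def fps_sum_nth tN)
  have AN: "(g * A N) $ i = 0" and BN: "(g * B N) $ i = 0" for g
    by (simp_all add: A_def B_def fps_mult_nth fps_sum_nth tN)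
  have SA: "SA $ j = fps_eval (boundary_gf a b c) w $ j" if "j \<le> i" for j
    using boundary_gf_partial_sum[OF w, of j N a b c] that
    by (simp add: SA_def A_def t_def kw_def N_def)
  have "t n 0 l = fps_const (kreweras_weight b a c n l 0) * (fps_X ^ (n - 2 * l) * (fps_X ^ 3 * y) ^ l)" for n l
  proof (cases "n < 2 * l")
    case True
    then show ?thesis
      using kreweras_weight_eq_0[of n 0 l a b c] kreweras_weight_eq_0[of n l 0 b a c] by (simp add: t_def kw_def)
  next
    case False
    then have "n + l = (n - 2 * l) + 3 * l" by simp
    then have *: "(fps_X :: 'a fps) ^ (n + l) = fps_X ^ (n - 2 * l) * (fps_X ^ 3) ^ l"
      by (metis power_add power_mult)
    have "t n 0 l = fps_const (kreweras_weight b a c n l 0) * (fps_X ^ (n + l) * y ^ l)"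
      by (simp add: t_def kw_def kreweras_weight_commute[of a])
    then show ?thesis unfolding * power_mult_distrib by (simp only: mult_ac)
  qed
  then have SB: "SB $ j = fps_eval (boundary_gf b a c) (fps_X ^ 3 * y) $ j" if "j \<le> i" for j
    using boundary_gf_partial_sum[of "fps_X ^ 3 * y" j N b a c] that
    by (simp add: SB_def B_def N_def)
  have SQ: "SQ $ j = boundary_gf a b c $ 0 $ j" if "j \<le> i" for j
  proof -
    have "SQ $ j = (\<Sum>n\<le>N. if n = j then kw n 0 0 else 0)"
      unfolding SQ_def fps_sum_nth by (rule sum.cong) (auto simp: t_def fps_X_power_iff)
    then show ?thesis using that by (simp add: N_def boundary_gf_def kw_def)
  qed
  have "M N $ i = (1 + fps_const \<alpha> * (SA - SQ) + fps_const \<beta> * (SB - SQ) +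
      fps_const \<gamma> * (SQ - 1) - W * (SA - A N) - \<xi> * (SB - B N)) $ i"
    using tele[of N] by (simp add: SA_def SB_def SQ_def)
  also have "\<dots> = (1 + fps_const \<alpha> * (SA - SQ) + fps_const \<beta> * (SB - SQ) +
      fps_const \<gamma> * (SQ - 1) - W * SA - \<xi> * SB) $ i"
    using AN[of W] BN[of \<xi>] by (simp add: right_diff_distrib)
  also have "\<dots> = (1 + fps_const \<alpha> * (fps_eval (boundary_gf a b c) w - boundary_gf a b c $ 0) +
      fps_const \<beta> * (fps_eval (boundary_gf b a c) (fps_X ^ 3 * y) - boundary_gf a b c $ 0) +
      fps_const \<gamma> * (boundary_gf a b c $ 0 - 1) - W * fps_eval (boundary_gf a b c) w -
      \<xi> * fps_eval (boundary_gf b a c) (fps_X ^ 3 * y)) $ i"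
  proof -
    have "(g * SA) $ i = (g * fps_eval (boundary_gf a b c) w) $ i"
      "(g * SB) $ i = (g * fps_eval (boundary_gf b a c) (fps_X ^ 3 * y)) $ i" for g
      unfolding fps_mult_nth by (auto intro!: sum.cong simp: SA SB)
    then show ?thesis by (simp add: SA SB SQ)
  qed
  also have "\<dots> = ?lhs $ i"
    by (rule arg_cong[where f = "\<lambda>f. f $ i"])
      (simp add: algebra_simps flip: fps_const_add fps_const_sub)
  finally show "?lhs $ i = 0 $ i" using MN by simp
qed

section \<open>Invariants\<close>

locale ring_map =
  fixes h :: "'a::comm_ring_1 \<Rightarrow> 'b::comm_ring_1"
  assumes one [simp]: "h 1 = 1"
    and add: "h (x + y) = h x + h y"
    and mult: "h (x * y) = h x * h y"
begin

lemma zero [simp]: "h 0 = 0"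
  using add[of 0 0] by simp

lemma uminus: "h (- x) = - h x"
  using add[of x "- x"] by (simp add: eq_neg_iff_add_eq_0 add.commute)

lemma diff: "h (x - y) = h x - h y"
  using add[of x "- y"] by (simp add: uminus)

lemma power: "h (x ^ n) = h x ^ n"
  by (induction n) (simp_all add: mult)

lemma sum: "h (sum f A) = (\<Sum>i\<in>A. h (f i))"
  by (induction A rule: infinite_finite_induct) (simp_all add: add)

lemmas hom = add mult uminus diff power

end

definition map_fps :: "('a \<Rightarrow> 'b) \<Rightarrow> 'a fps \<Rightarrow> 'b fps" where
  "map_fps h f = Abs_fps (\<lambda>n. h (f $ n))"

lemma map_fps_nth [simp]: "map_fps h f $ n = h (f $ n)"
  by (simp add: map_fps_def)

context ring_map
begin

lemma ring_map_map_fps: "ring_map (map_fps h)"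
proof
  show "map_fps h 1 = 1" by (rule fps_ext) simp
  show "map_fps h (f + g) = map_fps h f + map_fps h g" for f g
    by (rule fps_ext) (simp add: add)
  show "map_fps h (f * g) = map_fps h f * map_fps h g" for f g
    by (rule fps_ext) (simp add: fps_mult_nth sum mult)
qed

lemma map_fps_const [simp]: "map_fps h (fps_const c) = fps_const (h c)"
  by (rule fps_ext) simp

lemma map_fps_X [simp]: "map_fps h fps_X = fps_X"
  by (rule fps_ext) (simp add: fps_X_def)

lemma map_fps_boundary_gf:
  "map_fps (map_fps h) (boundary_gf a b c) = boundary_gf (h a) (h b) (h c)"
  by (intro fps_ext) (simp add: boundary_gf_def kreweras_weight_hom[of h] add mult)

end

lemma ring_map_fls_const: "ring_map (fls_const :: 'a::comm_ring_1 \<Rightarrow> _)"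
  by unfold_locales (simp_all add: fls_plus_const)

text \<open>Extends the scalars to Laurent series in a new variable z. This supplies generic
  evaluation points with coefficients in z and its inverse.\<close>

definition fps2_lift :: "'a::comm_ring_1 fps fps \<Rightarrow> 'a fls fps fps" where
  "fps2_lift f = map_fps (map_fps fls_const) f"

lemma ring_map_fps2_lift: "ring_map fps2_lift"
  unfolding fps2_lift_def
  by (intro ring_map.ring_map_map_fps ring_map_fls_const)

lemma ring_map_fps_eval: "w $ 0 = 0 \<Longrightarrow> ring_map (\<lambda>f. fps_eval f w)"
  by unfold_locales (simp_all add: fps_eval_add fps_eval_mult)

text \<open>
  The first argument has order \<open>2\<close> in \<open>t\<close>, the second order \<open>1\<close> with leading coefficient \<open>z\<close>;
  so in \<open>f(w\<^sub>1) = f(w\<^sub>2)\<close> the lowest nonconstant terms of the right side have nothing to cancel them.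
\<close>

lemma fps_eval_invariant_imp_const:
  fixes f :: "'a::comm_ring_1 fps fps" and W :: "'a fls fps"
  assumes W: "W $ 0 = 1"
    and inv: "fps_eval (fps2_lift f) (fps_const fls_X_inv * fps_X\<^sup>2) =
      fps_eval (fps2_lift f) (fps_const fls_X * fps_X * W)"
  shows "f = fps_const (f $ 0)"
proof (rule ccontr)
  assume "f \<noteq> fps_const (f $ 0)"
  then obtain k where "f $ k \<noteq> fps_const (f $ 0) $ k" by (auto simp: fps_eq_iff)
  then have "k \<noteq> 0" "f $ k \<noteq> 0" by (auto split: if_splits)
  moreover from this obtain j where "f $ k $ j \<noteq> 0" by (auto simp: fps_eq_iff)
  ultimately have ex: "\<exists>m k j. k \<noteq> 0 \<and> f $ k $ j \<noteq> 0 \<and> m = j + k" by blast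
  \<comment> \<open>The smallest total degree of a nonzero coefficient outside the constant term of
    the outer variable.\<close>
  define m where "m = (LEAST m. \<exists>k j. k \<noteq> 0 \<and> f $ k $ j \<noteq> 0 \<and> m = j + k)"
  obtain k j where kj: "k \<noteq> 0" "f $ k $ j \<noteq> 0" "m = j + k"
    using LeastI_ex[OF ex] unfolding m_def by blast
  have min: "f $ k $ j = 0" if "k \<noteq> 0" "j + k < m" for k j
    using not_less_Least[of "j + k" "\<lambda>m. \<exists>k j. k \<noteq> 0 \<and> f $ k $ j \<noteq> 0 \<and> m = j + k"] that
    unfolding m_def by blast
  define F where "F k = map_fps fls_const (f $ k)" for k
  have F: "fps2_lift f $ k = F k" "F k $ j = fls_const (f $ k $ j)" for k j
    by (simp_all add: F_def fps2_lift_def)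
  let ?w1 = "fps_const fls_X_inv * fps_X\<^sup>2 :: 'a fls fps"
  let ?w2 = "fps_const fls_X * fps_X * W"
  \<comment> \<open>At the first point a term with \<open>k \<noteq> 0\<close> would need a
    coefficient of total degree \<open>m - k\<close>, which vanishes by minimality.\<close>
  have t1: "(F k * ?w1 ^ k) $ m = (if k = 0 then fls_const (f $ 0 $ m) else 0)" for k
  proof -
    have "F k * ?w1 ^ k = fps_const (fls_X_inv ^ k) * (fps_X ^ (2 * k) * F k)"
      by (simp add: power_mult_distrib fps_const_power mult_ac flip: power_mult)
    then have "(F k * ?w1 ^ k) $ m =
        (if m < 2 * k then 0 else fls_X_inv ^ k * fls_const (f $ k $ (m - 2 * k)))"
      by (simp add: fps_X_power_mult_nth F)
    moreover have "f $ k $ (m - 2 * k) = 0" if "k \<noteq> 0" "\<not> m < 2 * k"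
      using that by (intro min) auto
    ultimately show ?thesis by auto
  qed
  have W_pow: "(W ^ k) $ 0 = 1" for k by (simp add: W fps_power_zeroth)
  \<comment> \<open>Higher terms of \<open>W\<close> and its powers would be multiplied by
    coefficients of total degree below \<open>m\<close>, so only the constant term 1 counts.\<close>
  have t2: "(F k * ?w2 ^ k) $ m = fls_X ^ k * fls_const (f $ k $ (m - k))" if "k \<le> m" for k
  proof -
    have "F k * ?w2 ^ k = fps_const (fls_X ^ k) * (fps_X ^ k * (F k * W ^ k))"
      by (simp add: power_mult_distrib fps_const_power mult_ac)
    then have "(F k * ?w2 ^ k) $ m = fls_X ^ k * (F k * W ^ k) $ (m - k)"
      using that by (simp add: fps_X_power_mult_nth)
    also have "(F k * W ^ k) $ (m - k) = fls_const (f $ k $ (m - k))"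
    proof (cases "k = 0")
      case False
      have "(F k * W ^ k) $ (m - k) = (\<Sum>i\<le>m - k. if i = m - k then fls_const (f $ k $ i) else 0)"
        unfolding fps_mult_nth atLeast0AtMost
      proof (rule sum.cong[OF refl])
        fix i assume "i \<in> {..m - k}"
        then show "F k $ i * W ^ k $ (m - k - i) = (if i = m - k then fls_const (f $ k $ i) else 0)"
          using min[of k i] False that by (cases "i = m - k") (auto simp: F W_pow)
      qed
      then show ?thesis by simp
    qed (simp add: F)
    finally show ?thesis .
  qed
  have "fps_eval (fps2_lift f) ?w1 $ m = (\<Sum>i\<le>m. if i = 0 then fls_const (f $ 0 $ m) else 0)"
    by (simp add: fps_eval_def F(1) t1)
  moreover have "fps_eval (fps2_lift f) ?w2 $ m = (\<Sum>i\<le>m. fls_X ^ i * fls_const (f $ i $ (m - i)))"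
    unfolding fps_eval_def fps_nth_Abs_fps F(1) by (rule sum.cong) (use t2 in auto)
  ultimately have "(\<Sum>i\<le>m. fls_X ^ i * fls_const (f $ i $ (m - i))) = fls_const (f $ 0 $ m)"
    using inv by simp
  \<comment> \<open>The powers of z keep the summands apart, so reading off the exponent
    \<open>k\<close> isolates the coefficient assumed nonzero.\<close>
  from arg_cong[OF this, of "\<lambda>g. fls_nth g (int k)"]
  have "(\<Sum>i\<le>m. fls_nth (fls_X ^ i * fls_const (f $ i $ (m - i))) (int k)) =
      fls_nth (fls_const (f $ 0 $ m)) (int k)"
    unfolding fls_nth_sum .
  moreover have "(\<Sum>i\<le>m. fls_nth (fls_X ^ i * fls_const (f $ i $ (m - i))) (int k)) =
      (\<Sum>i\<le>m. if i = k then f $ k $ (m - k) else 0)"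
    by (rule sum.cong) (auto simp: fls_X_power_times_conv_shift)
  ultimately show False using kj by simp
qed

text \<open>
  If \<open>\<theta> = \<xi> V W\<close>, \<open>w = V W\<close> and \<open>\<xi> + V + W = 1\<close>, then \<open>boundary_factor \<theta> w u = w (u - V) (u - W)\<close> and
  \<open>kernel_poly \<theta> w u = w\<^sup>2 (u - \<xi>) (u - V) (u - W)\<close>. So \<open>invariant_comb\<close> is \<open>w\<^sup>3\<close> times the multiple
  of \<open>A / (v - \<xi>) + B / (u - \<xi>)\<close> by the two kernel polynomials, plus the rational correction;
  \<open>reduced_comb\<close> is the same without the factor \<open>w\<^sup>3\<close>.
\<close>

definition boundary_factor :: "'a::comm_ring_1 \<Rightarrow> 'a \<Rightarrow> 'a \<Rightarrow> 'a" where
  "boundary_factor \<theta> w u = (u\<^sup>2 - u) * w + u * \<theta> + w\<^sup>2"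

definition kernel_poly :: "'a::comm_ring_1 \<Rightarrow> 'a \<Rightarrow> 'a \<Rightarrow> 'a" where
  "kernel_poly \<theta> w u = u * (\<theta> * w - \<theta>\<^sup>2 + w ^ 3) + (u ^ 3 - u\<^sup>2 - \<theta>) * w\<^sup>2"

definition invariant_comb :: "'a::comm_ring_1 \<Rightarrow> 'a \<Rightarrow> 'a \<Rightarrow> 'a \<Rightarrow> 'a \<Rightarrow> 'a \<Rightarrow> 'a \<Rightarrow> 'a" where
  "invariant_comb \<theta> w u v p A B =
     boundary_factor \<theta> w v * kernel_poly \<theta> w u * A + boundary_factor \<theta> w u * kernel_poly \<theta> w v * B +
     p * (\<theta> * (kernel_poly \<theta> w u + kernel_poly \<theta> w v) - (u - v)\<^sup>2 * ((u + v) * \<theta> * w\<^sup>2 - \<theta>\<^sup>2 * w))"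

definition reduced_poly :: "'a::comm_ring_1 \<Rightarrow> 'a \<Rightarrow> 'a \<Rightarrow> 'a" where
  "reduced_poly \<xi> w u = u * (\<xi> - \<xi>\<^sup>2 + w) + u ^ 3 - u\<^sup>2 - \<xi> * w"

definition reduced_comb :: "'a::comm_ring_1 \<Rightarrow> 'a \<Rightarrow> 'a \<Rightarrow> 'a \<Rightarrow> 'a \<Rightarrow> 'a \<Rightarrow> 'a \<Rightarrow> 'a" where
  "reduced_comb \<xi> w u v p A B =
     (v\<^sup>2 - v + v * \<xi> + w) * reduced_poly \<xi> w u * A + (u\<^sup>2 - u + u * \<xi> + w) * reduced_poly \<xi> w v * B +
     p * (\<xi> * (reduced_poly \<xi> w u + reduced_poly \<xi> w v) - (u - v)\<^sup>2 * ((u + v) * \<xi> - \<xi>\<^sup>2))"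

lemma (in ring_map) invariant_comb:
  "h (invariant_comb \<theta> w u v p A B) = invariant_comb (h \<theta>) (h w) (h u) (h v) (h p) (h A) (h B)"
  unfolding invariant_comb_def boundary_factor_def kernel_poly_def by (simp add: hom)

lemma invariant_comb_eq:
  fixes \<xi> :: "'a::comm_ring_1"
  shows "invariant_comb (\<xi> * w) w u v p A B = w ^ 3 * reduced_comb \<xi> w u v p A B"
proof -
  have 1: "boundary_factor (\<xi> * w) w u = w * (u\<^sup>2 - u + u * \<xi> + w)" for u
    unfolding boundary_factor_def by (simp add: algebra_simps power2_eq_square)
  have 2: "kernel_poly (\<xi> * w) w u = w\<^sup>2 * reduced_poly \<xi> w u" for u
    unfolding kernel_poly_def reduced_poly_def by (simp add: algebra_simps power2_eq_square power3_eq_cube)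
  have "invariant_comb (\<xi> * w) w u v p A B =
      w * w\<^sup>2 * ((v\<^sup>2 - v + v * \<xi> + w) * reduced_poly \<xi> w u * A + (u\<^sup>2 - u + u * \<xi> + w) * reduced_poly \<xi> w v * B) +
      p * (w * w\<^sup>2 * (\<xi> * (reduced_poly \<xi> w u + reduced_poly \<xi> w v)) - w * w\<^sup>2 * ((u - v)\<^sup>2 * ((u + v) * \<xi> - \<xi>\<^sup>2)))"
    unfolding invariant_comb_def 1 2 by (simp add: algebra_simps power2_eq_square)
  also have "\<dots> = w * w\<^sup>2 * reduced_comb \<xi> w u v p A B"
    unfolding reduced_comb_def by (simp only: distrib_left right_diff_distrib mult_ac)
  finally show ?thesis by (simp add: power3_eq_cube power2_eq_square mult_ac)
qed

text \<open>The pairs \<open>(\<xi>, W)\<close> and \<open>(V, W)\<close> share \<open>W\<close>,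
  hence the values \<open>C\<close>, \<open>D\<close> of the other boundary series. Eliminating
  \<open>A1\<close>, \<open>A2\<close>, \<open>B1\<close>, \<open>B2\<close> leaves the symmetric
  \<open>G\<close> plus \<open>p\<close> times \<open>R\<close>; the rational correction in
  \<open>reduced_comb\<close> is what makes \<open>R\<close> symmetric.\<close>

lemma reduced_comb_invariant:
  fixes \<xi> :: "'a::comm_ring_1"
  assumes W: "W = 1 - \<xi> - V"
    and A: "(u - W) * A1 + (v - \<xi>) * C + p = 0" "(u - W) * A2 + (v - V) * C + p = 0"
    and B: "(v - W) * B1 + (u - \<xi>) * D + p = 0" "(v - W) * B2 + (u - V) * D + p = 0"
  shows "reduced_comb \<xi> (V * W) u v p A1 B1 = reduced_comb V (\<xi> * W) u v p A2 B2"
proof -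
  have poly: "reduced_poly \<xi> (V * W) u = (u - \<xi>) * (u - V) * (u - W)"
    "reduced_poly V (\<xi> * W) u = (u - \<xi>) * (u - V) * (u - W)"
    "u\<^sup>2 - u + u * \<xi> + V * W = (u - V) * (u - W)"
    "u\<^sup>2 - u + u * V + \<xi> * W = (u - \<xi>) * (u - W)" for u
    unfolding reduced_poly_def W by (simp_all add: algebra_simps power2_eq_square power3_eq_cube)
  define G where "G = - (u - \<xi>) * (u - V) * (v - V) * (v - \<xi>) * ((v - W) * C + (u - W) * D)"
  define R where "R \<xi> V = \<xi> * ((u - \<xi>) * (u - V) * (u - W) + (v - \<xi>) * (v - V) * (v - W)) -
    (u - v)\<^sup>2 * ((u + v) * \<xi> - \<xi>\<^sup>2) - (v - V) * (v - W) * (u - \<xi>) * (u - V) -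
    (u - V) * (u - W) * (v - \<xi>) * (v - V)" for \<xi> V
  have elim: "(u - W) * A1 = - (v - \<xi>) * C - p" "(u - W) * A2 = - (v - V) * C - p"
    "(v - W) * B1 = - (u - \<xi>) * D - p" "(v - W) * B2 = - (u - V) * D - p"
    using A B by (simp_all add: algebra_simps eq_neg_iff_add_eq_0)
  have "reduced_comb \<xi> (V * W) u v p A1 B1 =
      (v - V) * (v - W) * (u - \<xi>) * (u - V) * ((u - W) * A1) +
      (u - V) * (u - W) * (v - \<xi>) * (v - V) * ((v - W) * B1) +
      p * (\<xi> * ((u - \<xi>) * (u - V) * (u - W) + (v - \<xi>) * (v - V) * (v - W)) -
        (u - v)\<^sup>2 * ((u + v) * \<xi> - \<xi>\<^sup>2))"
    unfolding reduced_comb_def poly by (simp only: mult_ac)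
  also have "\<dots> = G + p * R \<xi> V"
    unfolding elim G_def R_def by (simp add: algebra_simps)
  finally have 1: "reduced_comb \<xi> (V * W) u v p A1 B1 = G + p * R \<xi> V" .
  have "reduced_comb V (\<xi> * W) u v p A2 B2 =
      (v - \<xi>) * (v - W) * (u - V) * (u - \<xi>) * ((u - W) * A2) +
      (u - \<xi>) * (u - W) * (v - V) * (v - \<xi>) * ((v - W) * B2) +
      p * (V * ((u - \<xi>) * (u - V) * (u - W) + (v - \<xi>) * (v - V) * (v - W)) -
        (u - v)\<^sup>2 * ((u + v) * V - V\<^sup>2))"
    unfolding reduced_comb_def poly by (simp only: mult_ac)
  also have "\<dots> = G + p * R V \<xi>"
    unfolding elim G_def R_def by (simp add: algebra_simps)
  finally have 2: "reduced_comb V (\<xi> * W) u v p A2 B2 = G + p * R V \<xi>" .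
  have "R \<xi> V = R V \<xi>"
    unfolding R_def W by (simp add: algebra_simps power2_eq_square)
  then show ?thesis unfolding 1 2 by simp
qed

section \<open>Reduction of the invariant to a cubic in an invariant with a simple pole\<close>

lemma fps_X_mult_ex: "f $ 0 = 0 \<Longrightarrow> \<exists>g. f = fps_X * (g :: 'a::comm_ring_1 fps)"
  by (rule exI[of _ "fps_shift 1 f"], rule fps_ext) simp

text \<open>Successive elimination of the lowest coefficient by powers of \<open>J\<close>. As
  \<open>J $ 0\<close> need not be invertible, the steps multiply by its powers 3, 2 and 1, which
  accounts for the exponent 6.\<close>

lemma fps_decompose_along:
  fixes f J :: "'a::comm_ring_1 fps"
  shows "\<exists>c0 c1 c2 g. fps_const ((J $ 0) ^ 6) * f =
    fps_const ((J $ 0) ^ 3 * f $ 0) * J ^ 3 + fps_const c2 * (fps_X * J\<^sup>2) +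
    fps_const c1 * (fps_X\<^sup>2 * J) + fps_const c0 * fps_X ^ 3 + fps_X ^ 3 * (fps_X * g)"
proof -
  define \<delta> where "\<delta> = J $ 0"
  have J: "(J ^ n) $ 0 = \<delta> ^ n" for n by (simp add: \<delta>_def fps_power_zeroth)
  have step: "\<exists>g. fps_const (\<delta> ^ n) * f = fps_const (f $ 0) * J ^ n + fps_X * g" for n f
    using fps_X_mult_ex[of "fps_const (\<delta> ^ n) * f - fps_const (f $ 0) * J ^ n"]
    by (auto simp: J algebra_simps)
  obtain f1 where f1: "fps_const (\<delta> ^ 3) * f = fps_const (f $ 0) * J ^ 3 + fps_X * f1" using step by blast
  obtain f2 where f2: "fps_const (\<delta> ^ 2) * f1 = fps_const (f1 $ 0) * J ^ 2 + fps_X * f2" using step by blast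
  obtain f3 where f3: "fps_const (\<delta> ^ 1) * f2 = fps_const (f2 $ 0) * J ^ 1 + fps_X * f3" using step by blast
  obtain g where g: "fps_const (\<delta> ^ 0) * f3 = fps_const (f3 $ 0) * J ^ 0 + fps_X * g" using step by blast
  have "fps_const (\<delta> ^ 6) * f = fps_const (\<delta> ^ 3) * (fps_const (\<delta> ^ 3) * f)"
    by (simp flip: mult.assoc power_add)
  also have "\<dots> = fps_const (\<delta> ^ 3) * fps_const (f $ 0) * J ^ 3 +
      fps_X * (fps_const \<delta> * (fps_const (\<delta> ^ 2) * f1))"
    unfolding f1 by (simp add: algebra_simps power3_eq_cube power2_eq_square flip: fps_const_mult)
  also have "fps_const \<delta> * (fps_const (\<delta> ^ 2) * f1) =
      fps_const \<delta> * fps_const (f1 $ 0) * J\<^sup>2 + fps_X * (fps_const (\<delta> ^ 1) * f2)"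
    unfolding f2 by (simp only: distrib_left power_one_right mult_ac)
  also have "fps_const (\<delta> ^ 1) * f2 = fps_const (f2 $ 0) * J + fps_X * (fps_const (f3 $ 0) + fps_X * g)"
    unfolding f3 using g by simp
  finally have "fps_const (\<delta> ^ 6) * f = fps_const (\<delta> ^ 3 * f $ 0) * J ^ 3 +
      fps_const (\<delta> * f1 $ 0) * (fps_X * J\<^sup>2) + fps_const (f2 $ 0) * (fps_X\<^sup>2 * J) +
      fps_const (f3 $ 0) * fps_X ^ 3 + fps_X ^ 3 * (fps_X * g)"
    by (simp add: algebra_simps power3_eq_cube power2_eq_square flip: fps_const_mult)
  then show ?thesis unfolding \<delta>_def by blast
qed

text \<open>The square of the simple-pole invariant takes equal values at \<open>w1\<close> and
  \<open>w2\<close>, with denominators cleared. The difference is a combination of the kernel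
  relation and the equation for \<open>\<omega>\<close>.\<close>

lemma J_square_identity:
  fixes w1 w2 \<theta> \<omega> :: "'a::comm_ring_1"
  assumes \<omega>: "\<omega> = 2 + \<theta> * \<omega> ^ 3"
    and kernel: "\<theta>\<^sup>2 * (w1 + w2) - \<theta> * w1 * w2 + w1\<^sup>2 * w2\<^sup>2 = 0"
  shows "(\<theta> * \<omega> - w1)\<^sup>2 * (1 - \<omega>\<^sup>2 * w1) * w2\<^sup>2 = (\<theta> * \<omega> - w2)\<^sup>2 * (1 - \<omega>\<^sup>2 * w2) * w1\<^sup>2"
proof -
  have "(\<theta> * \<omega> - w1)\<^sup>2 * (1 - \<omega>\<^sup>2 * w1) * w2\<^sup>2 - (\<theta> * \<omega> - w2)\<^sup>2 * (1 - \<omega>\<^sup>2 * w2) * w1\<^sup>2 =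
      (w2 - w1) * \<omega>\<^sup>2 * (\<theta>\<^sup>2 * (w1 + w2) - \<theta> * w1 * w2 + w1\<^sup>2 * w2\<^sup>2) +
      (w2 - w1) * w1 * w2 * \<theta> * \<omega> * (\<omega> - (2 + \<theta> * \<omega> ^ 3))"
    by (simp add: algebra_simps power2_eq_square power3_eq_cube)
  also have "\<dots> = 0" using \<omega> kernel by simp
  finally show ?thesis by simp
qed

text \<open>The inhomogeneous term \<open>p\<close> of the kernel equation; it is unchanged when the
  two axes are exchanged.\<close>

definition excursion_factor :: "'a::comm_ring_1 \<Rightarrow> 'a \<Rightarrow> 'a \<Rightarrow> 'a fps \<Rightarrow> 'a fps" where
  "excursion_factor \<alpha> \<beta> \<gamma> Q = fps_const (1 - \<gamma>) + fps_const (\<gamma> - \<alpha> - \<beta>) * Q"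

lemma boundary_gf_0_commute: "boundary_gf b a c $ 0 = boundary_gf a b c $ 0"
  by (rule fps_ext) (simp add: boundary_gf_def kreweras_weight_commute[of b])

lemma kernel_equations:
  fixes a b c \<alpha> \<beta> \<gamma> :: "'a::comm_ring_1" and w y W \<xi> :: "'a fps"
  assumes inv: "a * (1 - \<alpha>) = 1" "b * (1 - \<beta>) = 1" "c * (1 - \<gamma>) = 1"
    and pt: "w $ 0 = 0" "\<xi> * w = fps_X ^ 3" "W * y = 1" "\<xi> + W + w * y = 1"
  defines "p \<equiv> excursion_factor \<alpha> \<beta> \<gamma> (boundary_gf a b c $ 0)"
  shows "(fps_const \<alpha> - W) * fps_eval (boundary_gf a b c) w +
      (fps_const \<beta> - \<xi>) * fps_eval (boundary_gf b a c) (fps_X ^ 3 * y) + p = 0"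
    and "(fps_const \<beta> - W) * fps_eval (boundary_gf b a c) w +
      (fps_const \<alpha> - \<xi>) * fps_eval (boundary_gf a b c) (fps_X ^ 3 * y) + p = 0"
proof -
  have *: "\<gamma> - \<beta> - \<alpha> = \<gamma> - \<alpha> - \<beta>" by simp
  show "(fps_const \<alpha> - W) * fps_eval (boundary_gf a b c) w +
      (fps_const \<beta> - \<xi>) * fps_eval (boundary_gf b a c) (fps_X ^ 3 * y) + p = 0"
    using kernel_equation[OF inv pt] unfolding p_def excursion_factor_def add.assoc .
  show "(fps_const \<beta> - W) * fps_eval (boundary_gf b a c) w +
      (fps_const \<alpha> - \<xi>) * fps_eval (boundary_gf a b c) (fps_X ^ 3 * y) + p = 0"
    using kernel_equation[OF inv(2) inv(1) inv(3) pt]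
    unfolding p_def excursion_factor_def add.assoc boundary_gf_0_commute[of b a c] * .
qed

definition invariant_gf :: "'a::comm_ring_1 \<Rightarrow> 'a \<Rightarrow> 'a \<Rightarrow> 'a \<Rightarrow> 'a \<Rightarrow> 'a \<Rightarrow> 'a fps fps" where
  "invariant_gf a b c \<alpha> \<beta> \<gamma> =
     invariant_comb (fps_const (fps_X ^ 3)) fps_X (fps_const (fps_const \<alpha>)) (fps_const (fps_const \<beta>))
       (fps_const (excursion_factor \<alpha> \<beta> \<gamma> (boundary_gf a b c $ 0))) (boundary_gf a b c) (boundary_gf b a c)"

lemma fps_eval_invariant_gf:
  assumes "w $ 0 = 0" "\<xi> * w = fps_X ^ 3"
  shows "fps_eval (invariant_gf a b c \<alpha> \<beta> \<gamma>) w = w ^ 3 *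
    reduced_comb \<xi> w (fps_const \<alpha>) (fps_const \<beta>) (excursion_factor \<alpha> \<beta> \<gamma> (boundary_gf a b c $ 0))
      (fps_eval (boundary_gf a b c) w) (fps_eval (boundary_gf b a c) w)"
proof -
  interpret ring_map "\<lambda>f. fps_eval f w" by (rule ring_map_fps_eval[OF assms(1)])
  show ?thesis
    unfolding invariant_gf_def invariant_comb fps_eval_const fps_eval_X[OF assms(1)] assms(2)[symmetric]
    by (rule invariant_comb_eq)
qed

lemma fps2_lift_invariant_gf:
  "fps2_lift (invariant_gf a b c \<alpha> \<beta> \<gamma>) =
   invariant_gf (fls_const a) (fls_const b) (fls_const c) (fls_const \<alpha>) (fls_const \<beta>) (fls_const \<gamma>)"
proof -
  interpret h0: ring_map "fls_const :: 'a \<Rightarrow> 'a fls" by (rule ring_map_fls_const)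
  interpret h1: ring_map "map_fps (fls_const :: 'a \<Rightarrow> 'a fls)" by (rule h0.ring_map_map_fps)
  interpret h2: ring_map "fps2_lift :: 'a fps fps \<Rightarrow> _" by (rule ring_map_fps2_lift)
  have const: "fps2_lift (fps_const f) = fps_const (map_fps fls_const f)" for f :: "'a fps"
    unfolding fps2_lift_def by simp
  have \<xi>: "fps2_lift fps_X = (fps_X :: 'a fls fps fps)" unfolding fps2_lift_def by simp
  have gf: "fps2_lift (boundary_gf a b c) = boundary_gf (fls_const a) (fls_const b) (fls_const c)" for a b c :: 'a
    unfolding fps2_lift_def by (rule h0.map_fps_boundary_gf)
  have "map_fps fls_const (boundary_gf a b c $ 0) = fps2_lift (boundary_gf a b c) $ 0"
    by (simp add: fps2_lift_def)
  then have Q: "map_fps fls_const (boundary_gf a b c $ 0) =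
      boundary_gf (fls_const a) (fls_const b) (fls_const c) $ 0"
    unfolding gf .
  have "map_fps fls_const (excursion_factor \<alpha> \<beta> \<gamma> (boundary_gf a b c $ 0)) =
      excursion_factor (fls_const \<alpha>) (fls_const \<beta>) (fls_const \<gamma>)
        (boundary_gf (fls_const a) (fls_const b) (fls_const c) $ 0)"
    unfolding excursion_factor_def by (simp only: h1.add h1.mult h0.map_fps_const h0.diff h0.one Q)
  then show ?thesis
    unfolding invariant_gf_def h2.invariant_comb const \<xi> gf
    by (simp only: h1.power h0.map_fps_X h0.map_fps_const)
qed

text \<open>
  The invariant with a simple pole at \<open>w = 0\<close> is \<open>pole_invariant \<omega> S / w\<close>. Its square is an affine function
  of the rational invariant \<open>X V + X W + V W\<close>, and \<open>\<omega>\<close> is chosen such that this function, a cubic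
  in \<open>w\<close> over \<open>w\<^sup>2\<close>, has the double root \<open>w = t\<^sup>3 \<omega>\<close>.
\<close>

definition pole_invariant :: "'a::comm_ring_1 fps \<Rightarrow> 'a fps fps \<Rightarrow> 'a fps fps" where
  "pole_invariant \<omega> S = (fps_const (fps_X ^ 3 * \<omega>) - fps_X) * S"

text \<open>Both \<open>\<Lambda>\<close> divided by the cube of the variable and \<open>J\<close>
  divided by the variable are invariant. Subtracting a cubic in the latter removes the pole and the
  constant term; the remainder is an invariant power series without constant term, hence 0.\<close>

lemma cubic_relation:
  fixes a b c \<alpha> \<beta> \<gamma> :: "'a::field_char_0"
  assumes inv: "a * (1 - \<alpha>) = 1" "b * (1 - \<beta>) = 1" "c * (1 - \<gamma>) = 1"
    and \<omega>: "\<omega> = 2 + fps_X ^ 3 * \<omega> ^ 3"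
    and S: "S\<^sup>2 = 1 - fps_const (\<omega>\<^sup>2) * fps_X" "S $ 0 = 1"
  defines "\<Lambda> \<equiv> invariant_gf a b c \<alpha> \<beta> \<gamma>" and "J \<equiv> pole_invariant \<omega> S" and "\<delta> \<equiv> fps_X ^ 3 * \<omega>"
  shows "\<exists>c0 c1 c2. fps_const (\<delta> ^ 6) * \<Lambda> = fps_const (\<delta> ^ 3 * \<Lambda> $ 0) * J ^ 3 +
    fps_const c2 * (fps_X * J\<^sup>2) + fps_const c1 * (fps_X\<^sup>2 * J) + fps_const c0 * fps_X ^ 3"
proof -
  \<comment> \<open>The generic point: \<open>z\<close> stands for 1/x, so that \<open>\<xi>\<close>
    becomes t z.\<close>
  define z zi :: "'a fls fps" where "z = fps_const fls_X" and "zi = fps_const fls_X_inv"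
  have zzi: "z * zi = 1"
    unfolding z_def zi_def by (simp add: fls_X_times_conv_shift)
  \<comment> \<open>\<open>T\<close> is the inverse of \<open>W\<close>: with
    \<open>V = w1 * T\<close>, the equation says \<open>\<xi> + V + W = 1\<close> multiplied by
    \<open>T\<close>.\<close>
  obtain T where T: "T = 1 + fps_X * (z * T + fps_X * zi * T\<^sup>2 + 0 * T ^ 3)"
    using fps_cubic_fixpoint by blast
  define w1 where "w1 = zi * fps_X\<^sup>2"
  define \<xi> where "\<xi> = fps_X * z"
  define V where "V = w1 * T"
  define W where "W = 1 - \<xi> - V"
  define w2 where "w2 = z * fps_X * W"
  have T_eq: "T = 1 + \<xi> * T + V * T"
    using T by (simp add: \<xi>_def V_def w1_def algebra_simps power2_eq_square)
  have WT: "W * T = 1"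
    using T_eq by (simp add: W_def algebra_simps)
  have W0: "W $ 0 = 1" by (simp add: W_def \<xi>_def V_def w1_def power2_eq_square mult.assoc)
  have w0: "w1 $ 0 = 0" "w2 $ 0 = 0" by (simp_all add: w1_def w2_def power2_eq_square)
  have w1: "w1 = V * W" using WT by (simp add: V_def mult_ac)
  have w2: "w2 = \<xi> * W" by (simp add: w2_def \<xi>_def mult_ac)
  have Xw1: "\<xi> * w1 = fps_X ^ 3"
  proof -
    have "\<xi> * w1 = (z * zi) * fps_X ^ 3" by (simp add: \<xi>_def w1_def power3_eq_cube power2_eq_square mult_ac)
    then show ?thesis by (simp add: zzi)
  qed
  have Vw2: "V * w2 = fps_X ^ 3" using Xw1 by (simp add: w1 w2 mult_ac)
  have XVW: "\<xi> + W + V = 1" by (simp add: W_def)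
  have V': "w1 * T = V" by (simp add: V_def)
  have \<xi>': "w2 * T = \<xi>" using WT by (simp add: w2 mult_ac)
  interpret h0: ring_map "fls_const :: 'a \<Rightarrow> 'a fls" by (rule ring_map_fls_const)
  interpret h1: ring_map "map_fps (fls_const :: 'a \<Rightarrow> 'a fls)" by (rule h0.ring_map_map_fps)
  interpret h2: ring_map "fps2_lift :: 'a fps fps \<Rightarrow> _" by (rule ring_map_fps2_lift)
  interpret e1: ring_map "\<lambda>f. fps_eval f w1" by (rule ring_map_fps_eval[OF w0(1)])
  interpret e2: ring_map "\<lambda>f. fps_eval f w2" by (rule ring_map_fps_eval[OF w0(2)])
  have const: "fps2_lift (fps_const f) = fps_const (map_fps fls_const f)" for f :: "'a fps"
    unfolding fps2_lift_def by simp
  have liftX: "fps2_lift fps_X = (fps_X :: 'a fls fps fps)" unfolding fps2_lift_def by simp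
  have inv': "fls_const a * (1 - fls_const \<alpha>) = 1" "fls_const b * (1 - fls_const \<beta>) = 1"
    "fls_const c * (1 - fls_const \<gamma>) = 1"
    using inv[THEN arg_cong, of fls_const] by (simp_all add: h0.mult h0.diff del: fls_const_mult_const)

  define L1 L2 where "L1 = fps_eval (fps2_lift \<Lambda>) w1" and "L2 = fps_eval (fps2_lift \<Lambda>) w2"
  have L: "L1 * w2 ^ 3 = L2 * w1 ^ 3"
  proof -
    note K1 = kernel_equations[OF inv' w0(1) Xw1 WT, unfolded V', OF XVW]
    have XVW': "V + W + \<xi> = 1" using XVW by (simp add: add_ac)
    note K2 = kernel_equations[OF inv' w0(2) Vw2 WT, unfolded \<xi>', OF XVW']
    note R = reduced_comb_invariant[OF W_def K1(1) K2(1) K1(2) K2(2), folded w1 w2]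
    show ?thesis
      unfolding L1_def L2_def \<Lambda>_def fps2_lift_invariant_gf
        fps_eval_invariant_gf[OF w0(1) Xw1] fps_eval_invariant_gf[OF w0(2) Vw2] R
      by (simp only: mult_ac)
  qed

  define J1 J2 where "J1 = fps_eval (fps2_lift J) w1" and "J2 = fps_eval (fps2_lift J) w2"
  define S1 S2 where "S1 = fps_eval (fps2_lift S) w1" and "S2 = fps_eval (fps2_lift S) w2"
  define \<omega>' where "\<omega>' = map_fps fls_const \<omega>"
  have \<omega>': "\<omega>' = 2 + fps_X ^ 3 * \<omega>' ^ 3"
  proof -
    have "map_fps fls_const \<omega> = map_fps fls_const (2 + fps_X ^ 3 * \<omega> ^ 3)"
      by (rule arg_cong[OF \<omega>])
    moreover have "map_fps fls_const (2 :: 'a fps) = (2 :: 'a fls fps)"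
      using h1.add[of 1 1] by simp
    ultimately show ?thesis unfolding \<omega>'_def by (simp only: h1.hom h0.map_fps_X)
  qed
  have J1: "J1 = (fps_X ^ 3 * \<omega>' - w1) * S1" and J2: "J2 = (fps_X ^ 3 * \<omega>' - w2) * S2"
    unfolding J1_def J2_def J_def pole_invariant_def S1_def S2_def \<omega>'_def
    by (simp_all add: h2.hom h1.hom e1.hom e2.hom const liftX fps_eval_X w0)
  have S1: "S1\<^sup>2 = 1 - \<omega>'\<^sup>2 * w1" and S2: "S2\<^sup>2 = 1 - \<omega>'\<^sup>2 * w2"
    unfolding S1_def S2_def \<omega>'_def e1.power[symmetric] e2.power[symmetric] h2.power[symmetric] S(1)
    by (simp_all add: h2.hom h1.hom e1.hom e2.hom const liftX fps_eval_X w0)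
  have S0: "S1 $ 0 = 1" "S2 $ 0 = 1"
    using S(2) by (simp_all add: S1_def S2_def fps_eval_def fps2_lift_def)
  have JJ: "J1 * w2 = J2 * w1"
  proof -
    have ker: "(fps_X ^ 3)\<^sup>2 * (w1 + w2) - fps_X ^ 3 * w1 * w2 + w1\<^sup>2 * w2\<^sup>2 = 0"
    proof -
      have *: "\<theta>\<^sup>2 * (w1 + w2) - \<theta> * w1 * w2 + w1\<^sup>2 * w2\<^sup>2 = \<theta>\<^sup>2 * (w1 + w2 - W + W\<^sup>2)"
        if "w1 * w2 = \<theta> * W" for \<theta>
      proof -
        have "\<theta>\<^sup>2 * (w1 + w2) - \<theta> * w1 * w2 + w1\<^sup>2 * w2\<^sup>2 =
            \<theta>\<^sup>2 * (w1 + w2) - \<theta> * (w1 * w2) + (w1 * w2)\<^sup>2"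
          by (simp add: mult.assoc power_mult_distrib)
        then show ?thesis unfolding that by (simp add: algebra_simps power2_eq_square)
      qed
      have "w1 * w2 = fps_X ^ 3 * W" using Xw1 by (simp add: w2 mult_ac)
      note *[OF this]
      moreover have "w1 + w2 - W + W\<^sup>2 = W * (\<xi> + W + V - 1)"
        by (simp add: w1 w2 algebra_simps power2_eq_square)
      ultimately show ?thesis using XVW by simp
    qed
    \<comment> \<open>Equal squares determine the two products only up to sign. After division by
      t^3 both have constant term -1, which excludes opposite signs in characteristic 0.\<close>
    define E1 E2 where "E1 = (fps_X * \<omega>' - zi) * z * W * S1" and "E2 = (fps_X\<^sup>2 * \<omega>' - z * W) * zi * S2"
    have JE: "J1 * w2 = fps_X ^ 3 * E1" "J2 * w1 = fps_X ^ 3 * E2"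
      unfolding J1 J2 E1_def E2_def w1_def w2_def
      by (simp_all add: algebra_simps power2_eq_square power3_eq_cube)
    have E0: "E1 $ 0 = - 1" "E2 $ 0 = - 1"
    proof -
      have "z $ 0 * zi $ 0 = 1" using arg_cong[OF zzi, of "\<lambda>f. f $ 0"] by simp
      moreover from this have "zi $ 0 * z $ 0 = 1" by (simp only: mult.commute)
      ultimately show "E1 $ 0 = - 1" "E2 $ 0 = - 1"
        by (simp_all add: E1_def E2_def W0 S0)
    qed
    have "(J1 * w2)\<^sup>2 = (J2 * w1)\<^sup>2"
      unfolding J1 J2 power_mult_distrib S1 S2 by (rule J_square_identity[OF \<omega>' ker])
    then have "J1 * w2 = J2 * w1 \<or> J1 * w2 = - (J2 * w1)"
      by (simp add: power2_eq_iff)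
    moreover have "J1 * w2 \<noteq> - (J2 * w1)"
    proof
      assume "J1 * w2 = - (J2 * w1)"
      then have "fps_X ^ 3 * (E1 + E2) = 0" unfolding JE by (simp add: algebra_simps eq_neg_iff_add_eq_0)
      then have "E1 + E2 = 0" by simp
      from arg_cong[OF this, of "\<lambda>f. f $ 0"] show False by (simp add: E0)
    qed
    ultimately show ?thesis by blast
  qed

  have J0: "J $ 0 = \<delta>" by (simp add: J_def pole_invariant_def \<delta>_def S)
  obtain c0 c1 c2 g where dec: "fps_const (\<delta> ^ 6) * \<Lambda> = fps_const (\<delta> ^ 3 * \<Lambda> $ 0) * J ^ 3 +
      fps_const c2 * (fps_X * J\<^sup>2) + fps_const c1 * (fps_X\<^sup>2 * J) + fps_const c0 * fps_X ^ 3 +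
      fps_X ^ 3 * (fps_X * g)"
    using fps_decompose_along[of J \<Lambda>] unfolding J0 by blast
  define d d3 d2 d1 d0 where "d = map_fps fls_const (\<delta> ^ 6)" and "d3 = map_fps fls_const (\<delta> ^ 3 * \<Lambda> $ 0)"
    and "d2 = map_fps fls_const c2" and "d1 = map_fps fls_const c1" and "d0 = map_fps fls_const c0"
  define g1 g2 where "g1 = fps_eval (fps2_lift (fps_X * g)) w1" and "g2 = fps_eval (fps2_lift (fps_X * g)) w2"
  have D1: "d * L1 = d3 * J1 ^ 3 + d2 * (w1 * J1\<^sup>2) + d1 * (w1\<^sup>2 * J1) + d0 * w1 ^ 3 + w1 ^ 3 * g1"
    using arg_cong[OF dec, of "\<lambda>f. fps_eval (fps2_lift f) w1"]
    unfolding L1_def J1_def d_def d0_def d1_def d2_def d3_def g1_def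
    by (simp add: h2.hom e1.hom const liftX fps_eval_X w0)
  have D2: "d * L2 = d3 * J2 ^ 3 + d2 * (w2 * J2\<^sup>2) + d1 * (w2\<^sup>2 * J2) + d0 * w2 ^ 3 + w2 ^ 3 * g2"
    using arg_cong[OF dec, of "\<lambda>f. fps_eval (fps2_lift f) w2"]
    unfolding L2_def J2_def d_def d0_def d1_def d2_def d3_def g2_def
    by (simp add: h2.hom e2.hom const liftX fps_eval_X w0)
  \<comment> \<open>After multiplication by \<open>v ^ 3\<close> the right side depends only on
    \<open>L * v ^ 3\<close>, \<open>J * v\<close> and \<open>w * v\<close>, which agree at the two
    points.\<close>
  have clear: "w ^ 3 * v ^ 3 * g = d * (L * v ^ 3) - d3 * (J * v) ^ 3 - d2 * (w * v * (J * v)\<^sup>2) -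
      d1 * ((w * v)\<^sup>2 * (J * v)) - d0 * (w * v) ^ 3"
    if "d * L = d3 * J ^ 3 + d2 * (w * J\<^sup>2) + d1 * (w\<^sup>2 * J) + d0 * w ^ 3 + w ^ 3 * g"
    for L J w v g :: "'a fls fps"
  proof -
    have "w ^ 3 * v ^ 3 * g = v ^ 3 * (w ^ 3 * g)" by (simp only: mult_ac)
    also have "w ^ 3 * g = d * L - (d3 * J ^ 3 + d2 * (w * J\<^sup>2) + d1 * (w\<^sup>2 * J) + d0 * w ^ 3)"
      unfolding that by simp
    finally show ?thesis by (simp add: algebra_simps power2_eq_square power3_eq_cube)
  qed
  have "w1 ^ 3 * w2 ^ 3 * g1 = w2 ^ 3 * w1 ^ 3 * g2"
    unfolding clear[OF D1] clear[OF D2] L JJ by (simp only: mult.commute[of w2 w1])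
  then have "w1 ^ 3 * w2 ^ 3 * g1 = w1 ^ 3 * w2 ^ 3 * g2" by (simp only: mult.commute[of "w2 ^ 3"])
  moreover have "w1 \<noteq> 0" "w2 \<noteq> 0" using Xw1 Vw2 by auto
  ultimately have "g1 = g2" by simp
  \<comment> \<open>The factor \<open>fps_X\<close> then forces the constant to be 0.\<close>
  then have "fps_X * g = fps_const ((fps_X * g) $ 0)"
    unfolding g1_def g2_def w1_def w2_def z_def zi_def by (intro fps_eval_invariant_imp_const[OF W0])
  then have "fps_X * g = 0" by simp
  then show ?thesis using dec by (intro exI[of _ c0] exI[of _ c1] exI[of _ c2]) simp
qed

section \<open>Algebraic series\<close>

lemma nat_pow_ring_of_type_algebra:
  "x [^]\<^bsub>ring_of_type_algebra\<^esub> (n::nat) = (x::'a::field) ^ n"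
  by (induction n) (simp_all add: ring_of_type_algebra_def nat_pow_def mult.commute)

text \<open>The list polynomials of HOL-Algebra begin with the leading coefficient, hence the
  reversal.\<close>

lemma eval_ring_of_type_algebra:
  "ring.eval ring_of_type_algebra p (x::'a::field) = poly (Poly (rev p)) x"
proof -
  interpret R: field "ring_of_type_algebra :: 'a ring" by (rule field_from_type_algebra)
  show ?thesis
  proof (induction p)
    case (Cons a p)
    have "poly (Poly (xs @ [a])) x = poly (Poly xs) x + a * x ^ length xs" for xs
      by (induction xs) (simp_all add: algebra_simps)
    from this[of "rev p"] Cons show ?case
      by (simp add: nat_pow_ring_of_type_algebra) (simp add: ring_of_type_algebra_def)
    qed (simp, simp add: ring_of_type_algebra_def)
qed

lemma inverses_ring_of_type_algebra:
  fixes x :: "'a::field"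
  shows "\<ominus>\<^bsub>ring_of_type_algebra\<^esub> x = - x"
    and "x \<noteq> 0 \<Longrightarrow> inv\<^bsub>ring_of_type_algebra\<^esub> x = inverse x"
proof -
  interpret R: field "ring_of_type_algebra :: 'a ring" by (rule field_from_type_algebra)
  show "\<ominus>\<^bsub>ring_of_type_algebra\<^esub> x = - x"
    by (rule R.minus_equality) (simp_all add: ring_of_type_algebra_def)
  show "inv\<^bsub>ring_of_type_algebra\<^esub> x = inverse x" if "x \<noteq> 0"
    by (rule R.comm_inv_char) (use that in \<open>simp_all add: ring_of_type_algebra_def\<close>)
qed

lemma subfield_ring_of_type_algebraI:
  fixes K :: "'a::field set"
  assumes "1 \<in> K" "\<And>x y. x \<in> K \<Longrightarrow> y \<in> K \<Longrightarrow> x - y \<in> K"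
    "\<And>x y. x \<in> K \<Longrightarrow> y \<in> K \<Longrightarrow> x * y \<in> K" "\<And>x. x \<in> K \<Longrightarrow> inverse x \<in> K"
  shows "subfield K ring_of_type_algebra"
proof -
  interpret R: field "ring_of_type_algebra :: 'a ring" by (rule field_from_type_algebra)
  have zero: "0 \<in> K" using assms(1) assms(2)[of 1 1] by simp
  have minus: "- x \<in> K" if "x \<in> K" for x using assms(2)[OF zero that] by simp
  have plus: "x + y \<in> K" if "x \<in> K" "y \<in> K" for x y
    using assms(2)[OF that(1) minus[OF that(2)]] by simp
  have a_inv: "\<ominus>\<^bsub>ring_of_type_algebra\<^esub> x = - x" for x :: 'a
    by (rule inverses_ring_of_type_algebra(1))
  note m_inv = inverses_ring_of_type_algebra(2)
  have "subring K ring_of_type_algebra"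
    by (rule R.subringI) (use assms zero minus plus a_inv in \<open>auto simp: ring_of_type_algebra_def\<close>)
  then show ?thesis
  proof (rule R.subfieldI')
    fix k assume "k \<in> K - {\<zero>\<^bsub>ring_of_type_algebra\<^esub>}"
    then show "inv\<^bsub>ring_of_type_algebra\<^esub> k \<in> K"
      using m_inv[of k] assms(4)[of k] by (auto simp: ring_of_type_algebra_def)
  qed
qed

text \<open>The bridge to \<open>subfield_of_algebraics\<close>, which yields closure under sums,
  products and inverses.\<close>

lemma algebraic_over_iff:
  fixes K :: "'a::field set"
  assumes K: "subfield K ring_of_type_algebra"
  shows "algebraic_over K z \<longleftrightarrow> (ring.algebraic ring_of_type_algebra over K) z"
proof -
  interpret R: field "ring_of_type_algebra :: 'a ring" by (rule field_from_type_algebra)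
  have sr: "subring K ring_of_type_algebra" using K by (rule subfieldE(1))
  have zero: "0 \<in> K"
    using subringE(2)[OF sr] by (simp add: ring_of_type_algebra_def)
  show ?thesis
  proof
    assume "algebraic_over K z"
    then obtain P where P: "\<forall>i. poly.coeff P i \<in> K" "P \<noteq> 0" "poly P z = 0"
      unfolding algebraic_over_def by blast
    have "set (rev (coeffs P)) \<subseteq> K"
      using P(1) by (auto simp: coeffs_def)
    moreover have "hd (rev (coeffs P)) \<noteq> 0"
      using P(2) by (simp add: hd_rev last_coeffs_eq_coeff_degree)
    ultimately have "rev (coeffs P) \<in> carrier (K[X]\<^bsub>ring_of_type_algebra\<^esub>)"
      using P(2) by (auto simp: univ_poly_def polynomial_def ring_of_type_algebra_def)
    then show "(ring.algebraic ring_of_type_algebra over K) z"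
      by (rule R.algebraicI)
        (use P in \<open>simp_all add: eval_ring_of_type_algebra, simp_all add: ring_of_type_algebra_def\<close>)
  next
    assume "(ring.algebraic ring_of_type_algebra over K) z"
    then obtain p where p: "p \<in> carrier (K[X]\<^bsub>ring_of_type_algebra\<^esub>)" "p \<noteq> []"
      "ring.eval ring_of_type_algebra p z = \<zero>\<^bsub>ring_of_type_algebra\<^esub>"
      by (rule R.algebraicE[OF sr, rotated]) (auto simp: ring_of_type_algebra_def)
    have set: "set p \<subseteq> K" and hd: "hd p \<noteq> 0"
      using p(1,2) by (auto simp: univ_poly_def polynomial_def ring_of_type_algebra_def)
    have coeff: "poly.coeff (Poly (rev p)) i = (if i < length p then rev p ! i else 0)" for i
      by (simp add: nth_default_def)
    have "rev p ! i \<in> K" if "i < length p" for i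
      using that set nth_mem[of i "rev p"] by auto
    then have "\<forall>i. poly.coeff (Poly (rev p)) i \<in> K"
      using zero unfolding coeff by simp
    moreover have "poly.coeff (Poly (rev p)) (length p - 1) \<noteq> 0"
      using hd p(2) unfolding coeff by (simp add: rev_nth hd_conv_nth)
    then have "Poly (rev p) \<noteq> 0" by (metis coeff_0)
    moreover have "poly (Poly (rev p)) z = 0"
      using p(3) unfolding eval_ring_of_type_algebra by (simp add: ring_of_type_algebra_def)
    ultimately show "algebraic_over K z"
      unfolding algebraic_over_def by blast
  qed
qed

lemma algebraic_over_base:
  assumes "1 \<in> K" "- z \<in> K" "0 \<in> K"
  shows "algebraic_over K z"
  unfolding algebraic_over_def
  by (rule exI[of _ "[:- z, 1:]"]) (use assms in \<open>auto simp: coeff_pCons split: nat.split\<close>)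

lemma algebraic_over_field_ops:
  fixes K :: "'a::field set"
  assumes K: "subfield K ring_of_type_algebra" and x: "algebraic_over K x"
  shows "algebraic_over K y \<Longrightarrow> algebraic_over K (x + y)"
    "algebraic_over K y \<Longrightarrow> algebraic_over K (x * y)"
    "algebraic_over K (- x)" "algebraic_over K (inverse x)"
proof -
  interpret R: field "ring_of_type_algebra :: 'a ring" by (rule field_from_type_algebra)
  let ?A = "{x \<in> carrier ring_of_type_algebra. (ring.algebraic ring_of_type_algebra over K) x}"
  have A: "z \<in> ?A \<longleftrightarrow> algebraic_over K z" for z
    by (simp add: algebraic_over_iff[OF K]) (simp add: ring_of_type_algebra_def)
  have sf: "subfield ?A ring_of_type_algebra" by (rule R.subfield_of_algebraics[OF K])
  note sr = subfieldE(1)[OF sf]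
  show "algebraic_over K (x + y)" if "algebraic_over K y"
    using subringE(7)[OF sr, of x y] x that unfolding A by (simp add: ring_of_type_algebra_def)
  show "algebraic_over K (x * y)" if "algebraic_over K y"
    using subringE(6)[OF sr, of x y] x that unfolding A by (simp add: ring_of_type_algebra_def)
  have a_inv: "\<ominus>\<^bsub>ring_of_type_algebra\<^esub> x = - x" for x :: 'a
    by (rule inverses_ring_of_type_algebra(1))
  show "algebraic_over K (- x)"
    using subringE(5)[OF sr, of x] x unfolding A a_inv .
  note m_inv = inverses_ring_of_type_algebra(2)
  show "algebraic_over K (inverse x)"
  proof (cases "x = 0")
    case False
    then have "x \<in> ?A - {\<zero>\<^bsub>ring_of_type_algebra\<^esub>}"
      using x A[of x] by (simp add: ring_of_type_algebra_def)
    then have "inv\<^bsub>ring_of_type_algebra\<^esub> x \<in> ?A - {\<zero>\<^bsub>ring_of_type_algebra\<^esub>}"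
      by (rule R.subfield_m_inv(1)[OF sf])
    then show ?thesis using m_inv[OF False] A[of "inverse x"] by simp
  qed (use x in simp)
qed

text \<open>An annihilating polynomial of the square, composed with the monomial of degree 2,
  annihilates \<open>z\<close>.\<close>

lemma algebraic_over_of_square:
  assumes "algebraic_over K (z\<^sup>2)"
    and K: "0 \<in> K" "1 \<in> K" "\<And>x y. x \<in> K \<Longrightarrow> y \<in> K \<Longrightarrow> x + y \<in> K"
      "\<And>x y. x \<in> K \<Longrightarrow> y \<in> K \<Longrightarrow> x * y \<in> K"
  shows "algebraic_over K z"
proof -
  obtain P where P: "\<forall>i. poly.coeff P i \<in> K" "P \<noteq> 0" "poly P (z\<^sup>2) = 0"
    using assms(1) unfolding algebraic_over_def by blast
  have "poly.coeff (pcompose P (Polynomial.monom 1 2)) i \<in> K" for i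
    using K P(1) by (intro coeff_pcompose_semiring_closed) (auto simp: coeff_monom)
  moreover have "pcompose P (Polynomial.monom 1 2) \<noteq> 0"
    using P(2) by (simp add: pcompose_eq_0_iff degree_monom_eq)
  moreover have "poly (pcompose P (Polynomial.monom 1 2)) z = 0"
    using P(3) by (simp add: poly_pcompose poly_monom)
  ultimately show ?thesis unfolding algebraic_over_def by blast
qed

section \<open>Algebraic series over the rational functions\<close>

lemma rational_functionsI: "fps_to_fls (fps_of_poly p) / fps_to_fls (fps_of_poly q) \<in> rational_functions"
proof (cases "q = 0")
  case True
  \<comment> \<open>Division by zero yields 0, which is also the fraction 0 / 1.\<close>
  then show ?thesis
    unfolding rational_functions_def by (intro CollectI exI[of _ 0] exI[of _ 1]) simp
qed (auto simp: rational_functions_def)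

lemma subfield_rational_functions:
  "subfield (rational_functions :: 'a::field fls set) ring_of_type_algebra"
proof (rule subfield_ring_of_type_algebraI)
  show "1 \<in> (rational_functions :: 'a fls set)"
    using rational_functionsI[of 1 1] by simp
  fix x y :: "'a fls" assume x: "x \<in> rational_functions"
  then obtain p q where pq: "x = fps_to_fls (fps_of_poly p) / fps_to_fls (fps_of_poly q)" "q \<noteq> 0"
    by (auto simp: rational_functions_def)
  show "inverse x \<in> rational_functions"
    using rational_functionsI[of q p] by (simp add: pq(1))
  assume "y \<in> rational_functions"
  then obtain p' q' where pq': "y = fps_to_fls (fps_of_poly p') / fps_to_fls (fps_of_poly q')" "q' \<noteq> 0"
    by (auto simp: rational_functions_def)
  show "x * y \<in> rational_functions"
    using rational_functionsI[of "p * p'" "q * q'"]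
    by (simp add: pq(1) pq'(1) fps_of_poly_mult fls_times_fps_to_fls)
  have "x - y = fps_to_fls (fps_of_poly (p * q' - p' * q)) / fps_to_fls (fps_of_poly (q * q'))"
    using pq(2) pq'(2)
    by (simp add: pq(1) pq'(1) fps_of_poly_mult fps_of_poly_diff fls_times_fps_to_fls
        fps_to_fls_minus diff_frac_eq)
  then show "x - y \<in> rational_functions" by (simp add: rational_functionsI)
qed

lemma rational_functions_of_poly: "fps_to_fls (fps_of_poly p) \<in> rational_functions"
  using rational_functionsI[of p 1] by simp

lemma subring_rational_functions:
  fixes x y :: "'a::field fls"
  shows "0 \<in> (rational_functions :: 'a fls set)" "1 \<in> (rational_functions :: 'a fls set)"
    "x \<in> rational_functions \<Longrightarrow> y \<in> rational_functions \<Longrightarrow> x + y \<in> rational_functions"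
    "x \<in> rational_functions \<Longrightarrow> y \<in> rational_functions \<Longrightarrow> x * y \<in> rational_functions"
proof -
  have sr: "subring (rational_functions :: 'a fls set) ring_of_type_algebra"
    by (rule subfieldE(1)[OF subfield_rational_functions])
  show "0 \<in> (rational_functions :: 'a fls set)"
    using subringE(2)[OF sr] by (simp add: ring_of_type_algebra_def)
  show "1 \<in> (rational_functions :: 'a fls set)"
    using subringE(3)[OF sr] by (simp add: ring_of_type_algebra_def)
  show "x \<in> rational_functions \<Longrightarrow> y \<in> rational_functions \<Longrightarrow> x + y \<in> rational_functions"
    using subringE(7)[OF sr, of x y] by (simp add: ring_of_type_algebra_def)
  show "x \<in> rational_functions \<Longrightarrow> y \<in> rational_functions \<Longrightarrow> x * y \<in> rational_functions"
    using subringE(6)[OF sr, of x y] by (simp add: ring_of_type_algebra_def)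
qed

abbreviation algebraic_fls :: "'a::field fls \<Rightarrow> bool" where
  "algebraic_fls \<equiv> algebraic_over rational_functions"

lemma algebraic_fls_poly: "algebraic_fls (fps_to_fls (fps_of_poly p))"
  using rational_functions_of_poly[of "- p"]
  by (intro algebraic_over_base subring_rational_functions) (simp add: fps_of_poly_uminus)

lemma algebraic_fls_cubic_root:
  assumes "p0 \<noteq> 0"
    and "fps_of_poly p0 + fps_of_poly p1 * f + fps_of_poly p2 * f\<^sup>2 + fps_of_poly p3 * f ^ 3 = 0"
  shows "algebraic_fps f"
proof -
  let ?c = "\<lambda>p. fps_to_fls (fps_of_poly p)"
  let ?P = "[:?c p0, ?c p1, ?c p2, ?c p3:]"
  have "poly.coeff ?P i \<in> rational_functions" for i
    using rational_functions_of_poly subring_rational_functions(1)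
    by (auto simp: coeff_pCons split: nat.split)
  moreover have "?P \<noteq> 0" using assms(1) by simp
  moreover have "poly ?P (fps_to_fls f) = fps_to_fls
      (fps_of_poly p0 + fps_of_poly p1 * f + fps_of_poly p2 * f\<^sup>2 + fps_of_poly p3 * f ^ 3)"
    by (simp add: fls_times_fps_to_fls power2_eq_square power3_eq_cube algebra_simps)
  ultimately show ?thesis
    unfolding algebraic_fps_def algebraic_over_def assms(2) by (intro exI[of _ ?P]) simp
qed

lemma algebraic_fls_ops:
  fixes x y :: "'a::field fls"
  assumes x: "algebraic_fls x"
  shows algebraic_fls_uminus: "algebraic_fls (- x)"
    and algebraic_fls_power: "algebraic_fls (x ^ n)"
    and algebraic_fls_add: "algebraic_fls y \<Longrightarrow> algebraic_fls (x + y)"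
    and algebraic_fls_diff: "algebraic_fls y \<Longrightarrow> algebraic_fls (x - y)"
    and algebraic_fls_mult: "algebraic_fls y \<Longrightarrow> algebraic_fls (x * y)"
    and algebraic_fls_divide: "algebraic_fls y \<Longrightarrow> algebraic_fls (x / y)"
proof -
  note ops = algebraic_over_field_ops[OF subfield_rational_functions]
  show "algebraic_fls (- x)" by (rule ops(3)[OF x])
  show "algebraic_fls (x ^ n)"
    using algebraic_fls_poly[of 1] by (induction n) (auto intro: ops(2) x)
  show "algebraic_fls (x + y)" if "algebraic_fls y" by (rule ops(1)[OF x that])
  show "algebraic_fls (x * y)" if "algebraic_fls y" by (rule ops(2)[OF x that])
  show "algebraic_fls (x - y)" if "algebraic_fls y"
    using ops(1)[OF x ops(3)[OF that]] by simp
  show "algebraic_fls (x / y)" if "algebraic_fls y"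
    using ops(2)[OF x ops(4)[OF that]] by (simp add: divide_inverse)
qed

lemma algebraic_fls_const: "algebraic_fls (fls_const c)"
  using algebraic_fls_poly[of "[:c:]"] by (simp add: fps_of_poly_const)

lemma algebraic_fls_X: "algebraic_fls fls_X"
  using algebraic_fls_poly[of "[:0, 1:]"] by (simp add: fps_of_poly_pCons)

lemma algebraic_fls_of_square: "algebraic_fls (x\<^sup>2) \<Longrightarrow> algebraic_fls x"
  by (rule algebraic_over_of_square[OF _ subring_rational_functions])

lemmas algebraic_intros = algebraic_fls_const algebraic_fls_X algebraic_fls_uminus algebraic_fls_power
  algebraic_fls_add algebraic_fls_diff algebraic_fls_mult algebraic_fls_divide

lemma algebraic_fps_ops:
  fixes f g :: "'a::field fps"
  assumes f: "algebraic_fps f"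
  shows algebraic_fps_power: "algebraic_fps (f ^ n)"
    and algebraic_fps_add: "algebraic_fps g \<Longrightarrow> algebraic_fps (f + g)"
    and algebraic_fps_diff: "algebraic_fps g \<Longrightarrow> algebraic_fps (f - g)"
    and algebraic_fps_mult: "algebraic_fps g \<Longrightarrow> algebraic_fps (f * g)"
  using algebraic_fls_ops[OF f[unfolded algebraic_fps_def]]
  unfolding algebraic_fps_def fps_to_fls_power fls_times_fps_to_fls fps_to_fls_plus fps_to_fls_minus
  by simp_all

lemma algebraic_fps_const: "algebraic_fps (fps_const c)"
  unfolding algebraic_fps_def by (simp add: algebraic_fls_const)

lemma algebraic_fps_1: "algebraic_fps 1"
  using algebraic_fps_const[of 1] by simp

lemma algebraic_fps_X: "algebraic_fps fps_X"
  unfolding algebraic_fps_def by (simp add: algebraic_fls_X)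

lemma algebraic_fps_of_square: "algebraic_fps (f\<^sup>2) \<Longrightarrow> algebraic_fps f"
  unfolding algebraic_fps_def fps_to_fls_power by (rule algebraic_fls_of_square)

lemmas algebraic_fps_intros = algebraic_fps_const algebraic_fps_1 algebraic_fps_X algebraic_fps_power
  algebraic_fps_add algebraic_fps_diff algebraic_fps_mult

section \<open>Interpolation of a cubic and the values at the nodes\<close>

definition cubic_divided_difference :: "'a::field \<Rightarrow> 'a \<Rightarrow> 'a \<Rightarrow> 'a \<Rightarrow> 'a \<Rightarrow> 'a \<Rightarrow> 'a \<Rightarrow> 'a \<Rightarrow> 'a" where
  "cubic_divided_difference y1 y2 y3 y4 e1 e2 e3 e4 =
    (((e1 - e2) / (y1 - y2) - (e1 - e3) / (y1 - y3)) / (y2 - y3) -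
     ((e1 - e2) / (y1 - y2) - (e1 - e4) / (y1 - y4)) / (y2 - y4)) / (y3 - y4)"

text \<open>Three rounds of divided differences lower a cubic to its leading coefficient. The common
  factor \<open>m\<close> stays outside, so that it can hold the unknown \<open>p\<close> while the
  nodes and the values \<open>e1\<close> to \<open>e4\<close> are algebraic.\<close>

lemma cubic_divided_difference:
  fixes m :: "'a::field"
  assumes e: "m * e1 = k * y1 ^ 3 + c2 * y1\<^sup>2 + c1 * y1 + c0" "m * e2 = k * y2 ^ 3 + c2 * y2\<^sup>2 + c1 * y2 + c0"
      "m * e3 = k * y3 ^ 3 + c2 * y3\<^sup>2 + c1 * y3 + c0" "m * e4 = k * y4 ^ 3 + c2 * y4\<^sup>2 + c1 * y4 + c0"
    and ne: "y1 \<noteq> y2" "y1 \<noteq> y3" "y1 \<noteq> y4" "y2 \<noteq> y3" "y2 \<noteq> y4" "y3 \<noteq> y4"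
  shows "m * cubic_divided_difference y1 y2 y3 y4 e1 e2 e3 e4 = k"
proof -
  have cancel: "m * (d / (x - y)) = z" if "m * d = (x - y) * z" "x \<noteq> y" for d x y z
  proof -
    have "m * (d / (x - y)) = (x - y) * z / (x - y)" unfolding that(1)[symmetric] by simp
    then show ?thesis using that(2) by simp
  qed
  have 1: "m * ((e - f) / (x - y)) = k * (x\<^sup>2 + x * y + y\<^sup>2) + c2 * (x + y) + c1"
    if "m * e = k * x ^ 3 + c2 * x\<^sup>2 + c1 * x + c0" "m * f = k * y ^ 3 + c2 * y\<^sup>2 + c1 * y + c0" "x \<noteq> y"
    for e f x y
  proof -
    have "m * (e - f) = (x - y) * (k * (x\<^sup>2 + x * y + y\<^sup>2) + c2 * (x + y) + c1)"
      unfolding right_diff_distrib that(1,2) by (simp add: algebra_simps power2_eq_square power3_eq_cube)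
    then show ?thesis using that(3) by (rule cancel)
  qed
  have 2: "m * ((f - g) / (x - y)) = k * (z + x + y) + c2"
    if "m * f = k * (z\<^sup>2 + z * x + x\<^sup>2) + c2 * (z + x) + c1"
      "m * g = k * (z\<^sup>2 + z * y + y\<^sup>2) + c2 * (z + y) + c1" "x \<noteq> y" for f g x y z
  proof -
    have "m * (f - g) = (x - y) * (k * (z + x + y) + c2)"
      unfolding right_diff_distrib that(1,2) by (simp add: algebra_simps power2_eq_square)
    then show ?thesis using that(3) by (rule cancel)
  qed
  have 3: "m * ((f - g) / (x - y)) = k"
    if "m * f = k * z + k * x + c2" "m * g = k * z + k * y + c2" "x \<noteq> y" for f g x y z
  proof -
    have "m * (f - g) = (x - y) * k"
      unfolding right_diff_distrib that(1,2) by (simp add: algebra_simps)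
    then show ?thesis using that(3) by (rule cancel)
  qed
  note a = 1[OF e(1,2) ne(1)] and b = 1[OF e(1,3) ne(2)] and c = 1[OF e(1,4) ne(3)]
  note ab = 2[OF a b ne(4)] and ac = 2[OF a c ne(5)]
  show ?thesis
    unfolding cubic_divided_difference_def
  proof (rule 3[OF _ _ ne(6)])
    show "m * (((e1 - e2) / (y1 - y2) - (e1 - e3) / (y1 - y3)) / (y2 - y3)) = k * (y1 + y2) + k * y3 + c2"
      unfolding ab by (simp only: distrib_left)
    show "m * (((e1 - e2) / (y1 - y2) - (e1 - e4) / (y1 - y4)) / (y2 - y4)) = k * (y1 + y2) + k * y4 + c2"
      unfolding ac by (simp only: distrib_left)
  qed
qed

lemma reduced_poly_factor: "reduced_poly \<xi> w u = (u - \<xi>) * (u\<^sup>2 - u + u * \<xi> + w)"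
  unfolding reduced_poly_def by (simp add: algebra_simps power2_eq_square power3_eq_cube)

definition node_value :: "'a::comm_ring_1 \<Rightarrow> 'a \<Rightarrow> 'a \<Rightarrow> 'a \<Rightarrow> 'a" where
  "node_value \<xi> w u v = \<xi> * (reduced_poly \<xi> w u + reduced_poly \<xi> w v) - (u - v)\<^sup>2 * ((u + v) * \<xi> - \<xi>\<^sup>2)"

lemma algebraic_fps_reduced_poly:
  assumes "algebraic_fps \<xi>" "algebraic_fps w" "algebraic_fps u"
  shows "algebraic_fps (reduced_poly \<xi> w u)"
  unfolding reduced_poly_def by (intro algebraic_fps_intros assms)

lemma algebraic_fps_node_value:
  assumes "algebraic_fps \<xi>" "algebraic_fps w" "algebraic_fps u" "algebraic_fps v"
  shows "algebraic_fps (node_value \<xi> w u v)"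
  unfolding node_value_def by (intro algebraic_fps_intros algebraic_fps_reduced_poly assms)

text \<open>By \<open>reduced_poly_factor\<close> the vanishing factor also divides
  \<open>reduced_poly \<xi> w v\<close>, so both boundary series drop out.\<close>

lemma reduced_comb_root:
  assumes "v\<^sup>2 - v + v * \<xi> + w = 0"
  shows "reduced_comb \<xi> w u v p A B = p * node_value \<xi> w u v"
  using assms by (simp add: reduced_comb_def node_value_def reduced_poly_factor[of \<xi> w v])

text \<open>At \<open>\<xi> = v\<close> the factor \<open>v - \<xi>\<close> removes
  \<open>B\<close>; \<open>A\<close> is left to the kernel equation.\<close>

lemma reduced_comb_pole:
  "reduced_comb v w u v p A B = p * node_value v w u v + (v\<^sup>2 - v + v * v + w) * reduced_poly v w u * A"
  by (simp add: reduced_comb_def node_value_def reduced_poly_factor[of v w v])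

lemma reduced_comb_commute: "reduced_comb \<xi> w u v p A B = reduced_comb \<xi> w v u p B A"
  by (simp add: reduced_comb_def algebra_simps power2_eq_square)

section \<open>Generic weights\<close>

text \<open>Both boundary series begin with Q(0, 0), so the coefficient of the triple pole is affine
  in the unknown.\<close>

lemma invariant_gf_0:
  "invariant_gf a b c \<alpha> \<beta> \<gamma> $ 0 = - ((fps_X ^ 3) ^ 3) *
     (2 * fps_const \<alpha> * fps_const \<beta> * (boundary_gf a b c $ 0) +
      (fps_const \<alpha> + fps_const \<beta>) * excursion_factor \<alpha> \<beta> \<gamma> (boundary_gf a b c $ 0))"
proof -
  interpret ring_map "\<lambda>f :: 'a fps fps. f $ 0" by unfold_locales simp_all
  have "invariant_comb \<theta> 0 u v p Q Q = - (\<theta> ^ 3) * (2 * u * v * Q + (u + v) * p)" for \<theta> u v p Q :: "'a fps"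
    unfolding invariant_comb_def boundary_factor_def kernel_poly_def
    by (simp add: algebra_simps power2_eq_square power3_eq_cube)
  then show ?thesis
    unfolding invariant_gf_def invariant_comb by (simp add: boundary_gf_0_commute[of b a])
qed

text \<open>One member of the kernel triple is fixed as \<open>x\<close>; the others are
  \<open>1 - x - t ^ 3 * v\<close> and \<open>t ^ 3 * v\<close>. The product condition is quadratic
  in \<open>v\<close>, solvable since \<open>x * (1 - x)\<close> is invertible.\<close>

lemma kernel_special_points:
  fixes x :: "'a::field"
  assumes x: "x \<noteq> 0" "x \<noteq> 1"
  obtains v where "algebraic_fps v"
    "(fps_const (1 - x) - fps_X ^ 3 * v) * (fps_const x * v) = 1"
proof -
  have x': "x\<^sup>2 - x \<noteq> 0" using x by (simp add: power2_eq_square)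
  obtain v where v: "v = fps_const (- 1 / (x\<^sup>2 - x)) +
      fps_X * (0 * v + fps_X\<^sup>2 * fps_const (- x / (x\<^sup>2 - x)) * v\<^sup>2 + 0 * v ^ 3)"
    using fps_cubic_fixpoint by blast
  have "fps_const (x\<^sup>2 - x) * v = fps_const (x\<^sup>2 - x) * (fps_const (- 1 / (x\<^sup>2 - x)) +
      fps_X * (0 * v + fps_X\<^sup>2 * fps_const (- x / (x\<^sup>2 - x)) * v\<^sup>2 + 0 * v ^ 3))"
    by (rule arg_cong[OF v])
  also have "\<dots> = fps_const ((x\<^sup>2 - x) * (- 1 / (x\<^sup>2 - x))) +
      fps_X ^ 3 * (fps_const ((x\<^sup>2 - x) * (- x / (x\<^sup>2 - x))) * v\<^sup>2)"
    unfolding fps_const_mult[symmetric] by (simp only: distrib_left mult_zero_left add_0_left add_0_right power2_eq_square power3_eq_cube mult_ac mult_zero_right)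
  also have "\<dots> = - 1 - fps_X ^ 3 * (fps_const x * v\<^sup>2)"
    using x' by (simp flip: fps_const_neg)
  finally have quad: "fps_const (x\<^sup>2 - x) * v = - 1 - fps_X ^ 3 * (fps_const x * v\<^sup>2)" .
  have "fps_const (x\<^sup>2 - x) = fps_const x * fps_const x - fps_const x"
    by (simp add: power2_eq_square)
  then have "(fps_const (1 - x) - fps_X ^ 3 * v) * (fps_const x * v) =
      - (fps_const (x\<^sup>2 - x) * v) - fps_X ^ 3 * (fps_const x * v\<^sup>2)"
    by (simp add: algebra_simps power2_eq_square flip: fps_const_sub)
  then have 1: "(fps_const (1 - x) - fps_X ^ 3 * v) * (fps_const x * v) = 1"
    unfolding quad by simp
  have "algebraic_fps v"
  proof (rule algebraic_fls_cubic_root)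
    have "fps_of_poly [:0, 0, 0, x:] = fps_X ^ 3 * fps_const x"
      by (simp add: fps_of_poly_pCons power3_eq_cube mult_ac)
    then show "fps_of_poly 1 + fps_of_poly [:x\<^sup>2 - x:] * v + fps_of_poly [:0, 0, 0, x:] * v\<^sup>2 +
        fps_of_poly 0 * v ^ 3 = 0"
      by (simp only: fps_of_poly_const quad) simp
  qed simp
  then show ?thesis using 1 that by blast
qed

text \<open>
  At \<open>w\<^sub>1\<close>, paired with \<open>W = \<xi>\<close>, the coefficient \<open>x - X\<close> in the kernel equation vanishes, which leaves a
  formula for the other boundary series; at \<open>w\<^sub>2\<close> the boundary factor of \<open>x\<close> vanishes.
\<close>

lemma pole_and_root:
  fixes x y :: "'a::field"
  assumes x: "x \<noteq> 0" "x \<noteq> 1"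
  obtains \<xi> \<eta> w1 w2 where "w1 $ 0 = 0" "fps_const x * w1 = fps_X ^ 3" "\<xi> * \<eta> = 1"
    "fps_const x + \<xi> + w1 * \<eta> = 1" "w2 $ 0 = 0" "\<xi> * w2 = fps_X ^ 3" "\<xi> $ 0 = 1 - x"
    "(fps_const x)\<^sup>2 - fps_const x + fps_const x * \<xi> + w2 = 0"
    "algebraic_fps \<xi>" "algebraic_fps w1" "algebraic_fps w2"
proof -
  obtain v where alg: "algebraic_fps v"
    and v: "(fps_const (1 - x) - fps_X ^ 3 * v) * (fps_const x * v) = 1"
    using kernel_special_points[OF x] by blast
  \<comment> \<open>The triple \<open>x\<close>, \<open>\<xi>\<close>, \<open>t ^ 3 * v\<close> has
    sum 1 and product t^3; \<open>w1\<close> and \<open>w2\<close> are t^3 divided by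
    \<open>x\<close> and by \<open>\<xi>\<close>.\<close>
  define \<xi> where "\<xi> = fps_const (1 - x) - fps_X ^ 3 * v"
  define w1 where "w1 = fps_const (1 / x) * fps_X ^ 3"
  define w2 where "w2 = fps_const x * v * fps_X ^ 3"
  have unit: "fps_const x * fps_const (1 / x) = 1" using x by simp
  show ?thesis
  proof (rule that[of w1 \<xi> "fps_const x * v" w2])
    have "fps_const x * w1 = (fps_const x * fps_const (1 / x)) * fps_X ^ 3"
      unfolding w1_def by (simp only: mult.assoc)
    then show "fps_const x * w1 = fps_X ^ 3" unfolding unit by simp
    have "w1 * (fps_const x * v) = (fps_const x * fps_const (1 / x)) * (fps_X ^ 3 * v)"
      unfolding w1_def by (simp only: mult_ac)
    then have "w1 * (fps_const x * v) = fps_X ^ 3 * v" unfolding unit by simp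
    then show "fps_const x + \<xi> + w1 * (fps_const x * v) = 1"
      unfolding \<xi>_def by (simp flip: fps_const_sub)
    show "\<xi> * (fps_const x * v) = 1" using v unfolding \<xi>_def .
    then have "\<xi> * (fps_const x * v) * fps_X ^ 3 = fps_X ^ 3" by simp
    then show "\<xi> * w2 = fps_X ^ 3" unfolding w2_def by (simp only: mult.assoc)
    show "(fps_const x)\<^sup>2 - fps_const x + fps_const x * \<xi> + w2 = 0"
      unfolding \<xi>_def w2_def by (simp add: algebra_simps power2_eq_square flip: fps_const_sub)
    show "algebraic_fps \<xi>" "algebraic_fps w1" "algebraic_fps w2"
      unfolding \<xi>_def w1_def w2_def by (intro algebraic_fps_intros alg)+
  qed (simp_all add: \<xi>_def w1_def w2_def)
qed

text \<open>The generic conditions make \<open>\<alpha>\<close>, \<open>\<beta>\<close>,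
  \<open>1 - \<alpha>\<close>, \<open>1 - \<beta>\<close> distinct, which separates the four nodes,
  and \<open>\<alpha> * \<beta>\<close> nonzero, which keeps the final linear equation from
  degenerating.\<close>

theorem algebraic_boundary_gf_0:
  fixes a b c \<alpha> \<beta> \<gamma> :: "'a::field_char_0"
  assumes inv: "a * (1 - \<alpha>) = 1" "b * (1 - \<beta>) = 1" "c * (1 - \<gamma>) = 1"
    and generic: "\<alpha> \<noteq> 0" "\<beta> \<noteq> 0" "\<alpha> \<noteq> \<beta>" "\<alpha> + \<beta> \<noteq> 1" "2 * \<alpha> \<noteq> 1" "2 * \<beta> \<noteq> 1"
  shows "algebraic_fps (boundary_gf a b c $ 0)"
proof -
  have not1: "\<alpha> \<noteq> 1" "\<beta> \<noteq> 1" "\<gamma> \<noteq> 1" using inv by auto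
  define \<theta> :: "'a fps" where "\<theta> = fps_X ^ 3"
  define Q where "Q = boundary_gf a b c $ 0"
  define p where "p = excursion_factor \<alpha> \<beta> \<gamma> Q"
  define u v where "u = fps_const \<alpha>" and "v = fps_const \<beta>"
  obtain \<omega> :: "'a fps" where \<omega>_fix: "\<omega> = 2 + fps_X * (0 * \<omega> + 0 * \<omega>\<^sup>2 + fps_X\<^sup>2 * \<omega> ^ 3)"
    using fps_cubic_fixpoint by blast
  have \<omega>: "\<omega> = 2 + fps_X ^ 3 * \<omega> ^ 3"
    by (rule trans[OF \<omega>_fix]) (simp add: power2_eq_square power3_eq_cube mult_ac)
  have \<omega>0: "\<omega> $ 0 = 2" using arg_cong[OF \<omega>_fix, of "\<lambda>f. f $ 0"] by simp
  have alg_\<omega>: "algebraic_fps \<omega>"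
  proof (rule algebraic_fls_cubic_root)
    have *: "fps_of_poly [:0, 0, 0, 1:] = (fps_X ^ 3 :: 'a fps)" "fps_of_poly [:2:] = (2 :: 'a fps)"
      by (simp_all add: fps_of_poly_pCons power3_eq_cube fps_of_poly_const mult_ac flip: numeral_fps_const)
    have "2 - \<omega> + fps_X ^ 3 * \<omega> ^ 3 = 0" using \<omega> by (simp add: algebra_simps)
    then show "fps_of_poly [:2:] + fps_of_poly (- 1) * \<omega> + fps_of_poly 0 * \<omega>\<^sup>2 +
        fps_of_poly [:0, 0, 0, 1:] * \<omega> ^ 3 = 0"
      unfolding * fps_of_poly_uminus by simp
  qed simp
  \<comment> \<open>With \<open>S = 1 + fps_X * h\<close> the required square becomes
    \<open>2 * h + fps_X * h ^ 2 = - \<omega> ^ 2\<close>, a fixed-point equation for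
    \<open>h\<close>.\<close>
  obtain h :: "'a fps fps" where h: "h = fps_const (- fps_const (1/2) * \<omega>\<^sup>2) +
      fps_X * (0 * h + fps_const (- fps_const (1/2)) * h\<^sup>2 + 0 * h ^ 3)"
    using fps_cubic_fixpoint by blast
  define S where "S = 1 + fps_X * h"
  have S0: "S $ 0 = 1" by (simp add: S_def)
  have S: "S\<^sup>2 = 1 - fps_const (\<omega>\<^sup>2) * fps_X"
  proof -
    have half: "2 * fps_const (fps_const (1/2 :: 'a)) = 1"
      unfolding numeral_fps_const fps_const_mult by (simp flip: numeral_fps_const)
    have "2 * h = - (2 * fps_const (fps_const (1/2))) * fps_const (\<omega>\<^sup>2) -
        fps_X * (2 * fps_const (fps_const (1/2)) * h\<^sup>2)"
      by (subst h) (simp add: algebra_simps flip: fps_const_mult fps_const_neg)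
    then have "2 * h = - fps_const (\<omega>\<^sup>2) - fps_X * h\<^sup>2"
      unfolding half by simp
    moreover have "S\<^sup>2 = 1 + fps_X * (2 * h + fps_X * h\<^sup>2)"
      unfolding S_def by (simp add: algebra_simps power2_eq_square)
    ultimately show ?thesis by (simp add: algebra_simps)
  qed
  obtain c0 c1 c2 where cubic: "fps_const ((\<theta> * \<omega>) ^ 6) * invariant_gf a b c \<alpha> \<beta> \<gamma> =
      fps_const ((\<theta> * \<omega>) ^ 3 * invariant_gf a b c \<alpha> \<beta> \<gamma> $ 0) * pole_invariant \<omega> S ^ 3 +
      fps_const c2 * (fps_X * (pole_invariant \<omega> S)\<^sup>2) + fps_const c1 * (fps_X\<^sup>2 * pole_invariant \<omega> S) +
      fps_const c0 * fps_X ^ 3"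
    using cubic_relation[OF inv \<omega> S S0] unfolding \<theta>_def by blast
  define m k where "m = (\<theta> * \<omega>) ^ 6 * p" and "k = (\<theta> * \<omega>) ^ 3 * invariant_gf a b c \<alpha> \<beta> \<gamma> $ 0"
  define red where "red \<xi> w = reduced_comb \<xi> w u v p (fps_eval (boundary_gf a b c) w) (fps_eval (boundary_gf b a c) w)"
    for \<xi> w
  have node: "\<exists>y. (\<theta> * \<omega>) ^ 6 * red \<xi> w = k * y ^ 3 + c2 * y\<^sup>2 + c1 * y + c0 \<and>
      y $ 0 = 2 * \<xi> $ 0 - 1 \<and> algebraic_fps y"
    if pt: "w $ 0 = 0" "\<xi> * w = \<theta>" and alg: "algebraic_fps \<xi>" "algebraic_fps w" for \<xi> w
  proof -
    interpret e: ring_map "\<lambda>f. fps_eval f w" by (rule ring_map_fps_eval[OF pt(1)])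
    define \<sigma> where "\<sigma> = fps_eval S w"
    \<comment> \<open>The value of the simple-pole invariant at the node, simplified by
      \<open>\<theta> = \<xi> * w\<close>. Its constant term is \<open>2 * \<xi> $ 0 - 1\<close>
      because \<open>\<omega>\<close> starts with 2.\<close>
    define y where "y = (\<xi> * \<omega> - 1) * \<sigma>"
    have "w \<noteq> 0" using pt(2) by (auto simp: \<theta>_def)
    have J: "fps_eval (pole_invariant \<omega> S) w = w * y"
      unfolding pole_invariant_def e.hom fps_eval_const fps_eval_X[OF pt(1)] \<sigma>_def[symmetric] y_def
        \<theta>_def[symmetric] pt(2)[symmetric] by (simp add: algebra_simps)
    have L: "fps_eval (invariant_gf a b c \<alpha> \<beta> \<gamma>) w = w ^ 3 * red \<xi> w"
      using fps_eval_invariant_gf[of w \<xi>] pt unfolding red_def u_def v_def p_def Q_def \<theta>_def by blast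
    have "(\<theta> * \<omega>) ^ 6 * (w ^ 3 * red \<xi> w) =
        k * (w * y) ^ 3 + c2 * (w * (w * y)\<^sup>2) + c1 * (w\<^sup>2 * (w * y)) + c0 * w ^ 3"
      using arg_cong[OF cubic, of "\<lambda>f. fps_eval f w"]
      unfolding e.hom fps_eval_const fps_eval_X[OF pt(1)] J L k_def .
    then have "w ^ 3 * ((\<theta> * \<omega>) ^ 6 * red \<xi> w) = w ^ 3 * (k * y ^ 3 + c2 * y\<^sup>2 + c1 * y + c0)"
      by (simp add: algebra_simps power2_eq_square power3_eq_cube)
    then have 1: "(\<theta> * \<omega>) ^ 6 * red \<xi> w = k * y ^ 3 + c2 * y\<^sup>2 + c1 * y + c0"
      using \<open>w \<noteq> 0\<close> by simp
    have "\<sigma> $ 0 = 1" by (simp add: \<sigma>_def fps_eval_def S0)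
    then have 2: "y $ 0 = 2 * \<xi> $ 0 - 1" by (simp add: y_def \<omega>0)
    have "\<sigma>\<^sup>2 = 1 - \<omega>\<^sup>2 * w"
      using arg_cong[OF S, of "\<lambda>f. fps_eval f w"]
      unfolding e.hom e.one fps_eval_const fps_eval_X[OF pt(1)] \<sigma>_def .
    moreover have "algebraic_fps (1 - \<omega>\<^sup>2 * w)"
      by (intro algebraic_fps_intros alg alg_\<omega>)
    ultimately have "algebraic_fps \<sigma>"
      by (simp add: algebraic_fps_of_square)
    then have 3: "algebraic_fps y"
      unfolding y_def by (intro algebraic_fps_intros alg alg_\<omega>)
    show ?thesis using 1 2 3 by blast
  qed
  obtain \<xi>b \<eta>b b1 b2 where b1: "b1 $ 0 = 0" "v * b1 = fps_X ^ 3" "\<xi>b * \<eta>b = 1" "v + \<xi>b + b1 * \<eta>b = 1"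
    and b2: "b2 $ 0 = 0" "\<xi>b * b2 = fps_X ^ 3" and b0: "\<xi>b $ 0 = 1 - \<beta>"
    and b_root: "v\<^sup>2 - v + v * \<xi>b + b2 = 0"
    and b_alg: "algebraic_fps \<xi>b" "algebraic_fps b1" "algebraic_fps b2"
    using pole_and_root[OF generic(2) not1(2)] unfolding v_def by metis
  obtain \<xi>a \<eta>a a1 a2 where a1: "a1 $ 0 = 0" "u * a1 = fps_X ^ 3" "\<xi>a * \<eta>a = 1" "u + \<xi>a + a1 * \<eta>a = 1"
    and a2: "a2 $ 0 = 0" "\<xi>a * a2 = fps_X ^ 3" and a0: "\<xi>a $ 0 = 1 - \<alpha>"
    and a_root: "u\<^sup>2 - u + u * \<xi>a + a2 = 0"
    and a_alg: "algebraic_fps \<xi>a" "algebraic_fps a1" "algebraic_fps a2"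
    using pole_and_root[OF generic(1) not1(1)] unfolding u_def by metis
  have uv_alg: "algebraic_fps u" "algebraic_fps v"
    unfolding u_def v_def by (rule algebraic_fps_const)+
  have b_pole: "(u - \<xi>b) * fps_eval (boundary_gf a b c) b1 + p = 0"
    using kernel_equations(1)[OF inv b1[unfolded v_def]] unfolding p_def Q_def u_def by simp
  have a_pole: "(v - \<xi>a) * fps_eval (boundary_gf b a c) a1 + p = 0"
    using kernel_equations(2)[OF inv a1[unfolded u_def]] unfolding p_def Q_def v_def by simp
  let ?f = "fps_to_fls :: 'a fps \<Rightarrow> 'a fls"
  have nz: "?f (\<xi>b - u) \<noteq> 0" "?f (\<xi>a - v) \<noteq> 0"
  proof -
    have "(\<xi>b - u) $ 0 \<noteq> 0" "(\<xi>a - v) $ 0 \<noteq> 0"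
      using generic(4) by (simp_all add: a0 b0 u_def v_def algebra_simps)
    then have "\<xi>b - u \<noteq> 0" "\<xi>a - v \<noteq> 0" by (metis fps_zero_nth)+
    then show "?f (\<xi>b - u) \<noteq> 0" "?f (\<xi>a - v) \<noteq> 0" by (simp_all only: fps_to_fls_eq_0_iff not_False_eq_True)
  qed

  \<comment> \<open>The values of the invariant at the four nodes, divided by \<open>p\<close>. In
    \<open>e1\<close> and \<open>e3\<close> the remaining boundary series is replaced by
    \<open>p\<close> over an algebraic series.\<close>
  define e1 where "e1 = ?f (node_value v b1 u v) +
      ?f ((v\<^sup>2 - v + v * v + b1) * reduced_poly v b1 u) / ?f (\<xi>b - u)"
  define e2 where "e2 = ?f (node_value \<xi>b b2 u v)"
  define e3 where "e3 = ?f (node_value u a1 v u) +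
      ?f ((u\<^sup>2 - u + u * u + a1) * reduced_poly u a1 v) / ?f (\<xi>a - v)"
  define e4 where "e4 = ?f (node_value \<xi>a a2 v u)"
  have pole: "?f (p * n + g * A) = ?f p * (?f n + ?f g / ?f (\<xi> - x))"
    if "(x - \<xi>) * A + p = 0" "?f (\<xi> - x) \<noteq> 0" for x \<xi> n g A
  proof -
    have "p = (\<xi> - x) * A" using that(1) by (simp add: algebra_simps)
    then have "?f p = ?f (\<xi> - x) * ?f A" by (simp only: fls_times_fps_to_fls)
    then have "?f A = ?f p / ?f (\<xi> - x)" using that(2) by (simp add: field_simps)
    then show ?thesis by (simp add: fls_times_fps_to_fls algebra_simps del: fps_to_fls_minus)
  qed
  have red1: "?f (red v b1) = ?f p * e1"
    unfolding red_def reduced_comb_pole e1_def by (rule pole[OF b_pole nz(1)])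
  have red2: "?f (red \<xi>b b2) = ?f p * e2"
    unfolding red_def reduced_comb_root[OF b_root] e2_def by (simp add: fls_times_fps_to_fls)
  have red3: "?f (red u a1) = ?f p * e3"
    unfolding red_def reduced_comb_commute[of _ _ u v] reduced_comb_pole e3_def by (rule pole[OF a_pole nz(2)])
  have red4: "?f (red \<xi>a a2) = ?f p * e4"
    unfolding red_def reduced_comb_commute[of _ _ u v] reduced_comb_root[OF a_root] e4_def
    by (simp add: fls_times_fps_to_fls)
  have alg_f: "algebraic_fls (?f g)" if "algebraic_fps g" for g
    using that unfolding algebraic_fps_def .
  have e_alg: "algebraic_fls e1" "algebraic_fls e2" "algebraic_fls e3" "algebraic_fls e4"
    unfolding e1_def e2_def e3_def e4_def
    by (intro algebraic_fls_add algebraic_fls_divide alg_f algebraic_fps_intros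
        algebraic_fps_reduced_poly algebraic_fps_node_value uv_alg a_alg b_alg)+

  have node': "\<exists>y. ?f m * e = ?f k * y ^ 3 + ?f c2 * y\<^sup>2 + ?f c1 * y + ?f c0 \<and>
      fls_nth y 0 = 2 * \<xi> $ 0 - 1 \<and> algebraic_fls y"
    if pt: "w $ 0 = 0" "\<xi> * w = fps_X ^ 3" "algebraic_fps \<xi>" "algebraic_fps w" "?f (red \<xi> w) = ?f p * e"
    for \<xi> w e
  proof -
    obtain y where y: "(\<theta> * \<omega>) ^ 6 * red \<xi> w = k * y ^ 3 + c2 * y\<^sup>2 + c1 * y + c0"
      "y $ 0 = 2 * \<xi> $ 0 - 1" "algebraic_fps y"
      using node[OF pt(1) _ pt(3,4)] pt(2) unfolding \<theta>_def by blast
    have "?f m * e = ?f ((\<theta> * \<omega>) ^ 6 * red \<xi> w)"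
      unfolding m_def by (simp add: fls_times_fps_to_fls pt(5))
    also have "\<dots> = ?f k * ?f y ^ 3 + ?f c2 * (?f y)\<^sup>2 + ?f c1 * ?f y + ?f c0"
      unfolding y(1) by (simp add: fls_times_fps_to_fls fps_to_fls_power)
    finally show ?thesis
      using y(2,3) unfolding algebraic_fps_def by (intro exI[of _ "?f y"]) simp
  qed
  obtain y1 where y1: "?f m * e1 = ?f k * y1 ^ 3 + ?f c2 * y1\<^sup>2 + ?f c1 * y1 + ?f c0"
    "fls_nth y1 0 = 2 * \<beta> - 1" "algebraic_fls y1"
    using node'[OF b1(1,2) uv_alg(2) b_alg(2) red1] by (auto simp: v_def)
  obtain y2 where y2: "?f m * e2 = ?f k * y2 ^ 3 + ?f c2 * y2\<^sup>2 + ?f c1 * y2 + ?f c0"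
    "fls_nth y2 0 = 2 * (1 - \<beta>) - 1" "algebraic_fls y2"
    using node'[OF b2 b_alg(1,3) red2] by (auto simp: b0)
  obtain y3 where y3: "?f m * e3 = ?f k * y3 ^ 3 + ?f c2 * y3\<^sup>2 + ?f c1 * y3 + ?f c0"
    "fls_nth y3 0 = 2 * \<alpha> - 1" "algebraic_fls y3"
    using node'[OF a1(1,2) uv_alg(1) a_alg(2) red3] by (auto simp: u_def)
  obtain y4 where y4: "?f m * e4 = ?f k * y4 ^ 3 + ?f c2 * y4\<^sup>2 + ?f c1 * y4 + ?f c0"
    "fls_nth y4 0 = 2 * (1 - \<alpha>) - 1" "algebraic_fls y4"
    using node'[OF a2 a_alg(1,3) red4] by (auto simp: a0)
  have half: "x \<noteq> 1 - x" if "2 * x \<noteq> 1" for x :: 'a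
    using that by (metis add_diff_cancel_right' diff_add_cancel mult_2)
  have ne: "y1 \<noteq> y2" "y1 \<noteq> y3" "y1 \<noteq> y4" "y2 \<noteq> y3" "y2 \<noteq> y4" "y3 \<noteq> y4"
  proof -
    have *: "y \<noteq> z" if "fls_nth y 0 = 2 * s - 1" "fls_nth z 0 = 2 * t - 1" "s \<noteq> t" for y z and s t :: 'a
      using that by auto
    have "\<beta> \<noteq> 1 - \<alpha>" "1 - \<beta> \<noteq> \<alpha>" using generic(4) by (auto simp: algebra_simps)
    then show "y1 \<noteq> y2" "y1 \<noteq> y3" "y1 \<noteq> y4" "y2 \<noteq> y3" "y2 \<noteq> y4" "y3 \<noteq> y4"
      using generic(3) half[OF generic(5)] half[OF generic(6)]
      by (intro *[OF y1(2) y2(2)] *[OF y1(2) y3(2)] *[OF y1(2) y4(2)] *[OF y2(2) y3(2)] *[OF y2(2) y4(2)]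
          *[OF y3(2) y4(2)]; simp)+
  qed
  define E where "E = cubic_divided_difference y1 y2 y3 y4 e1 e2 e3 e4"
  have E_alg: "algebraic_fls E"
    unfolding E_def cubic_divided_difference_def
    by (intro algebraic_intros y1(3) y2(3) y3(3) y4(3) e_alg)
  have "?f m * E = ?f k"
    unfolding E_def by (rule cubic_divided_difference[OF y1(1) y2(1) y3(1) y4(1) ne])
  \<comment> \<open>Both expressions for the leading coefficient of the cubic contain this nonzero
    factor, which is then cancelled.\<close>
  then have "?f ((\<theta> * \<omega>) ^ 3 * \<theta> ^ 3) * (?f (\<omega> ^ 3 * p) * E) =
      ?f ((\<theta> * \<omega>) ^ 3 * \<theta> ^ 3) * - ?f (2 * u * v * Q + (u + v) * p)"
  proof -
    have "m = ((\<theta> * \<omega>) ^ 3 * \<theta> ^ 3) * (\<omega> ^ 3 * p)"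
      unfolding m_def by (simp add: power_mult_distrib mult_ac flip: power_add)
    moreover have "k = ((\<theta> * \<omega>) ^ 3 * \<theta> ^ 3) * - (2 * u * v * Q + (u + v) * p)"
      unfolding k_def invariant_gf_0 \<theta>_def u_def v_def Q_def p_def by (simp only: mult_minus_left mult_minus_right mult_ac)
    ultimately show ?thesis using \<open>?f m * E = ?f k\<close>
      by (simp only: fls_times_fps_to_fls fps_to_fls_uminus mult_ac)
  qed
  moreover have "(\<theta> * \<omega>) ^ 3 * \<theta> ^ 3 \<noteq> 0" using \<omega>0 by (auto simp: \<theta>_def)
  ultimately have main: "?f (\<omega> ^ 3 * p) * E = - ?f (2 * u * v * Q + (u + v) * p)"
    by simp
  \<comment> \<open>\<open>\<kappa>\<close> is the total coefficient of \<open>p\<close>; inserting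
    the affine form of \<open>p\<close> makes \<open>D\<close> the coefficient of
    \<open>Q\<close>.\<close>
  define \<kappa> where "\<kappa> = fls_const \<alpha> + fls_const \<beta> + ?f \<omega> ^ 3 * E"
  define D where "D = fls_const (2 * \<alpha> * \<beta>) + fls_const (\<gamma> - \<alpha> - \<beta>) * \<kappa>"
  have \<kappa>_alg: "algebraic_fls \<kappa>"
    using alg_\<omega> unfolding \<kappa>_def algebraic_fps_def by (intro algebraic_intros E_alg)
  have p_fls: "?f p = fls_const (1 - \<gamma>) + fls_const (\<gamma> - \<alpha> - \<beta>) * ?f Q"
    unfolding p_def excursion_factor_def by (simp only: fps_to_fls_plus fls_times_fps_to_fls fps_const_to_fls)
  have two: "?f (2 * u * v * Q) = fls_const (2 * \<alpha> * \<beta>) * ?f Q"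
  proof -
    have "2 * u * v = fps_const (2 * \<alpha> * \<beta>)"
      unfolding u_def v_def by (simp add: numeral_fps_const)
    then show ?thesis by (simp only: fls_times_fps_to_fls fps_const_to_fls)
  qed
  have "fls_const (2 * \<alpha> * \<beta>) * ?f Q + \<kappa> * ?f p = 0"
  proof -
    have "?f (2 * u * v * Q + (u + v) * p) = fls_const (2 * \<alpha> * \<beta>) * ?f Q + (fls_const \<alpha> + fls_const \<beta>) * ?f p"
      unfolding fps_to_fls_plus two by (simp only: fls_times_fps_to_fls fps_to_fls_plus u_def v_def fps_const_to_fls)
    then have "?f \<omega> ^ 3 * ?f p * E = - (fls_const (2 * \<alpha> * \<beta>) * ?f Q + (fls_const \<alpha> + fls_const \<beta>) * ?f p)"
      using main by (simp only: fls_times_fps_to_fls fps_to_fls_power)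
    moreover have "fls_const (2 * \<alpha> * \<beta>) * ?f Q + \<kappa> * ?f p =
        (fls_const (2 * \<alpha> * \<beta>) * ?f Q + (fls_const \<alpha> + fls_const \<beta>) * ?f p) + ?f \<omega> ^ 3 * ?f p * E"
      unfolding \<kappa>_def by (simp only: distrib_left distrib_right mult_ac add_ac)
    ultimately show ?thesis by simp
  qed
  moreover have "D * ?f Q + fls_const (1 - \<gamma>) * \<kappa> = fls_const (2 * \<alpha> * \<beta>) * ?f Q + \<kappa> * ?f p"
    unfolding p_fls D_def by (simp only: distrib_left distrib_right mult_ac add_ac)
  ultimately have QD: "D * ?f Q = - (fls_const (1 - \<gamma>) * \<kappa>)"
    by (simp only: eq_neg_iff_add_eq_0)
  \<comment> \<open>If \<open>D\<close> vanished, then \<open>\<kappa>\<close> would vanish by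
    \<open>QD\<close>, and \<open>D\<close> would equal the nonzero constant
    \<open>2 * \<alpha> * \<beta>\<close>. No information about \<open>E\<close> enters.\<close>
  have "D \<noteq> 0"
  proof
    assume D: "D = 0"
    then have "\<kappa> = 0" using QD not1(3) by simp
    then show False using D generic(1,2) unfolding D_def by simp
  qed
  then have "?f Q = - (fls_const (1 - \<gamma>) * \<kappa>) / D" using QD by (simp add: field_simps)
  moreover have "algebraic_fls (- (fls_const (1 - \<gamma>) * \<kappa>) / D)"
    unfolding D_def by (intro algebraic_intros \<kappa>_alg)
  ultimately show ?thesis unfolding algebraic_fps_def Q_def by simp
qed

section \<open>Specialization of the weights\<close>

lemma ring_map_fps_to_fls: "ring_map (fps_to_fls :: 'a::comm_ring_1 fps \<Rightarrow> 'a fls)"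
  by unfold_locales (simp_all add: fls_times_fps_to_fls)

text \<open>Clearing denominators gives a relation with polynomial coefficients, to which
  coefficientwise maps can be applied.\<close>

lemma algebraic_fps_iff:
  fixes f :: "'a::field fps"
  shows "algebraic_fps f \<longleftrightarrow>
    (\<exists>n p. (\<exists>k\<le>n. p k \<noteq> 0) \<and> (\<Sum>i\<le>n. fps_of_poly (p i) * f ^ i) = 0)"
proof
  let ?c = "\<lambda>p :: 'a poly. fps_to_fls (fps_of_poly p)"
  assume "algebraic_fps f"
  then obtain P where P: "\<And>i. poly.coeff P i \<in> rational_functions" "P \<noteq> 0" "poly P (fps_to_fls f) = 0"
    unfolding algebraic_fps_def algebraic_over_def by blast
  define n where "n = Polynomial.degree P"
  have "\<exists>num den. poly.coeff P i = ?c num / ?c den \<and> den \<noteq> 0" for i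
    using P(1)[of i] unfolding rational_functions_def by auto
  then obtain num den where nd: "\<And>i. poly.coeff P i = ?c (num i) / ?c (den i)" "\<And>i. den i \<noteq> 0"
    by metis
  define d where "d = (\<Prod>i\<le>n. den i)"
  define p where "p i = num i * (\<Prod>j\<in>{..n} - {i}. den j)" for i
  have p: "?c d * poly.coeff P i = ?c (p i)" if "i \<le> n" for i
  proof -
    have "d = den i * (\<Prod>j\<in>{..n} - {i}. den j)"
      unfolding d_def by (rule prod.remove) (use that in auto)
    then show ?thesis using nd(2)[of i]
      by (simp add: nd(1)[of i] p_def fps_of_poly_mult fls_times_fps_to_fls)
  qed
  have "d \<noteq> 0" by (simp add: d_def nd(2))
  have "poly.coeff P n \<noteq> 0" using P(2) by (simp add: n_def)
  moreover have "?c d \<noteq> 0" using \<open>d \<noteq> 0\<close> by simp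
  ultimately have "?c (p n) \<noteq> 0" unfolding p[OF le_refl, symmetric] by simp
  then have "p n \<noteq> 0" by auto
  moreover have "(\<Sum>i\<le>n. fps_of_poly (p i) * f ^ i) = 0"
  proof -
    have "fps_to_fls (\<Sum>i\<le>n. fps_of_poly (p i) * f ^ i) = (\<Sum>i\<le>n. ?c d * (poly.coeff P i * fps_to_fls f ^ i))"
      unfolding ring_map.sum[OF ring_map_fps_to_fls]
      by (rule sum.cong) (simp_all add: fls_times_fps_to_fls fps_to_fls_power p[symmetric] mult.assoc)
    also have "\<dots> = ?c d * poly P (fps_to_fls f)"
      by (simp add: poly_altdef n_def sum_distrib_left)
    finally show ?thesis using P(3) by simp
  qed
  ultimately show "\<exists>n p. (\<exists>k\<le>n. p k \<noteq> 0) \<and> (\<Sum>i\<le>n. fps_of_poly (p i) * f ^ i) = 0" by blast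
next
  let ?c = "\<lambda>p :: 'a poly. fps_to_fls (fps_of_poly p)"
  assume "\<exists>n p. (\<exists>k\<le>n. p k \<noteq> 0) \<and> (\<Sum>i\<le>n. fps_of_poly (p i) * f ^ i) = 0"
  then obtain n p k where k: "k \<le> n" "p k \<noteq> 0" and sum: "(\<Sum>i\<le>n. fps_of_poly (p i) * f ^ i) = 0" by blast
  define P where "P = (\<Sum>i\<le>n. Polynomial.monom (?c (p i)) i)"
  have coeff: "poly.coeff P i = (if i \<le> n then ?c (p i) else 0)" for i
    by (simp add: P_def coeff_sum)
  have "\<forall>i. poly.coeff P i \<in> rational_functions"
    unfolding coeff using rational_functions_of_poly subring_rational_functions(1) by auto
  moreover have "P \<noteq> 0" using k coeff[of k] by auto
  moreover have "poly P (fps_to_fls f) = fps_to_fls (\<Sum>i\<le>n. fps_of_poly (p i) * f ^ i)"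
    unfolding ring_map.sum[OF ring_map_fps_to_fls]
    by (simp add: P_def poly_sum poly_monom fls_times_fps_to_fls fps_to_fls_power)
  ultimately show "algebraic_fps f"
    unfolding algebraic_fps_def algebraic_over_def sum by (intro exI[of _ P]) simp
qed

lemma ring_map_fps_nth_0: "ring_map (\<lambda>f :: 'a::comm_ring_1 fps. f $ 0)"
  by unfold_locales simp_all

text \<open>
  A relation over \<open>F((\<epsilon>))(t)\<close> is scaled by the power of \<open>\<epsilon>\<close> that makes its coefficients power series
  in \<open>\<epsilon>\<close>, not all vanishing at \<open>\<epsilon> = 0\<close>.
\<close>

lemma algebraic_fps_specialize:
  fixes f :: "'a::field fps fps"
  assumes "algebraic_fps (map_fps fps_to_fls f)"
  shows "algebraic_fps (map_fps (\<lambda>g. g $ 0) f)"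
proof -
  interpret l: ring_map "fps_to_fls :: 'a fps \<Rightarrow> 'a fls" by (rule ring_map_fps_to_fls)
  interpret L: ring_map "map_fps (fps_to_fls :: 'a fps \<Rightarrow> 'a fls)" by (rule l.ring_map_map_fps)
  interpret z: ring_map "\<lambda>g :: 'a fps. g $ 0" by (rule ring_map_fps_nth_0)
  interpret Z: ring_map "map_fps (\<lambda>g :: 'a fps. g $ 0)" by (rule z.ring_map_map_fps)
  obtain n p k where k: "k \<le> n" "p k \<noteq> 0"
    and sum: "(\<Sum>i\<le>n. fps_of_poly (p i) * map_fps fps_to_fls f ^ i) = 0"
    using assms unfolding algebraic_fps_iff by blast
  define C where "C = (\<Union>i\<le>n. set (coeffs (p i))) - {0}"
  have "poly.coeff (p k) (Polynomial.degree (p k)) \<in> C"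
    using k by (auto simp: C_def coeffs_def)
  then have C: "finite C" "C \<noteq> {}" by (auto simp: C_def)
  \<comment> \<open>The lowest order in \<open>\<epsilon>\<close> among all nonzero coefficients of
    the relation.\<close>
  define m where "m = Min (fls_subdegree ` C)"
  have m_le: "m \<le> fls_subdegree c" if "c \<in> C" for c
    unfolding m_def using C that by (intro Min_le) auto
  have "m \<in> fls_subdegree ` C" unfolding m_def using C by (intro Min_in) auto
  then obtain c where c: "c \<in> C" "m = fls_subdegree c" by auto
  then obtain i0 j0 where ij: "i0 \<le> n" "c = poly.coeff (p i0) j0" "c \<noteq> 0"
    by (auto simp: C_def coeffs_def split: if_splits)
  \<comment> \<open>Shifting by \<open>m\<close> leaves no negative powers, so taking the regular
    part loses nothing.\<close>
  define q where "q i = Abs_fps (\<lambda>j. fls_regpart (fls_shift m (poly.coeff (p i) j)))" for i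
  have q: "map_fps fps_to_fls (q i) = fps_const (fls_X_intpow (- m)) * fps_of_poly (p i)" if "i \<le> n" for i
  proof (rule fps_ext)
    fix j
    show "map_fps fps_to_fls (q i) $ j = (fps_const (fls_X_intpow (- m)) * fps_of_poly (p i)) $ j"
    proof (cases "poly.coeff (p i) j = 0")
      case False
      then have "p i \<noteq> 0" by auto
      from coeff_in_coeffs[OF this le_degree[OF False]] have "poly.coeff (p i) j \<in> C"
        using that False by (auto simp: C_def intro!: bexI[of _ i])
      then have "0 \<le> fls_subdegree (fls_shift m (poly.coeff (p i) j))"
        using m_le False by simp
      then show ?thesis
        using fls_X_intpow_times_conv_shift(1)[of "- m" "poly.coeff (p i) j"]
        by (simp add: q_def fls_regpart_to_fls_trivial)
    qed (simp add: q_def)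
  qed
  have "map_fps fps_to_fls (\<Sum>i\<le>n. q i * f ^ i) =
      (\<Sum>i\<le>n. fps_const (fls_X_intpow (- m)) * (fps_of_poly (p i) * map_fps fps_to_fls f ^ i))"
    unfolding L.sum by (rule sum.cong) (simp_all add: L.mult L.power q mult.assoc)
  also have "\<dots> = 0"
    using sum by (simp flip: sum_distrib_left)
  finally have "(\<Sum>i\<le>n. q i * f ^ i) = 0"
    by (simp add: fps_eq_iff)
  then have "(\<Sum>i\<le>n. map_fps (\<lambda>g. g $ 0) (q i) * map_fps (\<lambda>g. g $ 0) f ^ i) = 0"
    using Z.sum[of "\<lambda>i. q i * f ^ i" "{..n}"] by (simp add: Z.mult Z.power Z.zero)
  moreover define r where "r i = Abs_poly (\<lambda>j. q i $ j $ 0)" for i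
  have coeff_r: "poly.coeff (r i) j = q i $ j $ 0" for i j
    unfolding r_def
    by (subst Abs_poly_inverse) (auto simp: q_def MOST_nat coeff_eq_0 intro!: exI[of _ "Polynomial.degree (p i)"])
  have "fps_of_poly (r i) = map_fps (\<lambda>g. g $ 0) (q i)" for i
    by (rule fps_ext) (simp add: coeff_r)
  \<comment> \<open>The coefficient \<open>c\<close> attains the minimal order, so after the shift
    it survives at \<open>\<epsilon> = 0\<close>.\<close>
  moreover have "r i0 \<noteq> 0"
  proof
    assume "r i0 = 0"
    then have "q i0 $ j0 $ 0 = 0" using coeff_r[of i0 j0] by simp
    then have "fls_nth c m = 0" by (simp add: q_def ij(2))
    then show False using ij(3) by (simp add: c(2))
  qed
  ultimately show ?thesis
    unfolding algebraic_fps_iff using ij(1) by (intro exI[of _ n] exI[of _ r]) auto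
qed

theorem corollary3:
  fixes a b c :: real
  shows "algebraic_fps
    (walk_gf kreweras_steps 0 0 (complex_of_real a) (complex_of_real b) (complex_of_real c))"
proof -
  \<comment> \<open>The perturbed weights are nonconstant in \<open>\<epsilon>\<close>, hence
    invertible as Laurent series and different from 1 and 2 even if the given weights are not. The
    slopes 1 and 2 separate \<open>A\<close> from \<open>B\<close>, and the quadratic term of
    \<open>A * B\<close> separates it from \<open>A + B\<close>, which excludes
    \<open>\<alpha> + \<beta> = 1\<close>.\<close>
  define A B C :: "complex fps" where "A = fps_const (complex_of_real a) + fps_X"
    and "B = fps_const (complex_of_real b) + 2 * fps_X" and "C = fps_const (complex_of_real c) + fps_X"
  have nth: "A $ 1 = 1" "B $ 1 = 2" "C $ 1 = 1" "A $ 2 = 0" "B $ 2 = 0"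
    by (simp_all add: A_def B_def C_def numeral_fps_const)
  have ne: "A \<noteq> 0" "B \<noteq> 0" "C \<noteq> 0" "A \<noteq> 1" "B \<noteq> 1" "A \<noteq> 2" "B \<noteq> 2" "A \<noteq> B"
    using nth by (auto simp: numeral_fps_const)
  have "(A * B) $ 2 = 2"
    using nth by (simp add: fps_mult_nth numeral_2_eq_2)
  then have ne': "A + B \<noteq> A * B" using nth by (metis fps_add_nth add_0 zero_neq_numeral)
  let ?f = "fps_to_fls :: complex fps \<Rightarrow> complex fls"
  define \<alpha> \<beta> \<gamma> where "\<alpha> = 1 - 1 / ?f A" and "\<beta> = 1 - 1 / ?f B" and "\<gamma> = 1 - 1 / ?f C"
  interpret l: ring_map ?f by (rule ring_map_fps_to_fls)
  have f2: "?f 2 = 2" using l.add[of 1 1] by simp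
  have fne: "?f A \<noteq> 0" "?f B \<noteq> 0" "?f C \<noteq> 0" "?f A \<noteq> 1" "?f B \<noteq> 1" "?f A \<noteq> 2" "?f B \<noteq> 2" "?f A \<noteq> ?f B"
    "?f A + ?f B \<noteq> ?f A * ?f B"
  proof -
    have "?f A \<noteq> ?f 0" "?f B \<noteq> ?f 0" "?f C \<noteq> ?f 0" "?f A \<noteq> ?f 1" "?f B \<noteq> ?f 1"
      "?f A \<noteq> ?f 2" "?f B \<noteq> ?f 2" "?f A \<noteq> ?f B" "?f (A + B) \<noteq> ?f (A * B)"
      unfolding fps_to_fls_eq_iff by (fact ne ne')+
    then show "?f A \<noteq> 0" "?f B \<noteq> 0" "?f C \<noteq> 0" "?f A \<noteq> 1" "?f B \<noteq> 1" "?f A \<noteq> 2" "?f B \<noteq> 2"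
      "?f A \<noteq> ?f B" "?f A + ?f B \<noteq> ?f A * ?f B"
      unfolding l.zero l.one f2 l.add l.mult .
  qed
  interpret z: ring_map "\<lambda>g :: complex fps. g $ 0" by (rule ring_map_fps_nth_0)
  have "algebraic_fps (boundary_gf (?f A) (?f B) (?f C) $ 0)"
  proof (rule algebraic_boundary_gf_0)
    show "?f A * (1 - \<alpha>) = 1" "?f B * (1 - \<beta>) = 1" "?f C * (1 - \<gamma>) = 1"
      using fne by (simp_all add: \<alpha>_def \<beta>_def \<gamma>_def)
    show "\<alpha> \<noteq> 0" "\<beta> \<noteq> 0" "\<alpha> \<noteq> \<beta>" "\<alpha> + \<beta> \<noteq> 1" "2 * \<alpha> \<noteq> 1" "2 * \<beta> \<noteq> 1"
      using fne by (auto simp: \<alpha>_def \<beta>_def field_simps)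
  qed
  moreover have "map_fps ?f (boundary_gf A B C $ 0) = boundary_gf (?f A) (?f B) (?f C) $ 0"
    using l.map_fps_boundary_gf[of A B C] by (metis map_fps_nth)
  ultimately have "algebraic_fps (map_fps (\<lambda>g. g $ 0) (boundary_gf A B C $ 0))"
    by (intro algebraic_fps_specialize) simp
  also have "map_fps (\<lambda>g. g $ 0) (boundary_gf A B C $ 0) = boundary_gf (A $ 0) (B $ 0) (C $ 0) $ 0"
    using z.map_fps_boundary_gf[of A B C] by (metis map_fps_nth)
  also have "\<dots> = walk_gf kreweras_steps 0 0 (complex_of_real a) (complex_of_real b) (complex_of_real c)"
    by (rule fps_ext) (simp add: boundary_gf_def walk_gf_nth A_def B_def C_def)
  finally show ?thesis .
qed

end
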